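(* Let $\Omega=[0,1)$ with Lebesgue measure $\mathbb P$ and let $p(\cdot):[0,1)\to(0,\infty)$ be measurable with $p_-=\operatorname{ess\,inf}p$, $p_+=\operatorname{ess\,sup}p$, $0<p_-\le p_+<\infty$. Assume that there is a constant $K\ge 1$ such that $\mathbb P(A)^{p_-(A)-p_+(A)}\le K$ for every dyadic interval $A\subset[0,1)$, and that $\frac1{p_-}-\frac1{p_+}<1$. If $1/2<p_-<\infty$, then there is a constant $C$ (independent of $f$) such that $$\|\sigma_*f\|_{p(\cdot)}\le C\,\|f\|_{H_{p(\cdot)}}\qquad\text{for all } f\in H_{p(\cdot)}.$$
   Context: For measurable $A\subset[0,1)$, $p_-(A)=\operatorname{ess\,inf}_{x\in A}p(x)$ and $p_+(A)=\operatorname{ess\,sup}_{x\in A}p(x)$. The quasi-norm of $L_{p(\cdot)}$ is $\|f\|_{p(\cdot)}=\inf\{\lambda>0:\int_0^1(|f(x)|/\lambda)^{p(x)}dx\le1\}$. Dyadic intervals are $[k2^{-n},(k+1)2^{-n})$, $n\in\mathbb N=\{0,1,2,\dots\}$, $0\le k<2^n$; $\mathcal F_n$ is the $\sigma$-algebra generated by the dyadic intervals of length $2^{-n}$. Martingales $f=(f_n)_{n\ge0}$ are taken with respect to $(\mathcal F_n)$. $M(f)=\sup_{n\ge0}|f_n|$. $H_{p(\cdot)}$ is the space of martingales with $\|f\|_{H_{p(\cdot)}}=\|M(f)\|_{p(\cdot)}<\infty$ (the paper uses this notation for any of five martingale Hardy spaces, which coincide with equivalent quasi-norms in the dyadic setting;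 this is one of them). Walsh system: $r(x)=1$ on $[0,1/2)$, $r(x)=-1$ on $[1/2,1)$, extended with period 1; $r_n(x)=r(2^nx)$; for $n=\sum_{k\ge0}n_k2^k$ with $n_k\in\{0,1\}$, $w_n=\prod_{k\ge0}r_k^{n_k}$. For a martingale $f$, $\widehat f(n)=\lim_{k\to\infty}\mathbb E(f_kw_n)$ (the sequence is eventually constant). Partial sums: $s_nf=\sum_{k=0}^{n-1}\widehat f(k)w_k$. Fejér means: $\sigma_nf=\frac1n\sum_{k=1}^ns_kf$, $n\ge1$. Maximal Fejér operator: $\sigma_*f=\sup_{n\ge1}|\sigma_nf|$. *)

theory Defs
  imports "HOL-Probability.Conditional_Expectation" "HOL-Probability.Essential_Supremum"
begin

section \<open>Variable exponent quasi-norms on \<open>[0,1)\<close>\<close>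

abbreviation unit_lebesgue :: "real measure"
  where "unit_lebesgue \<equiv> lebesgue_on {0..<1}"

definition essinf :: "'a measure \<Rightarrow> ('a \<Rightarrow> ereal) \<Rightarrow> ereal"
  where "essinf M f = - esssup M (\<lambda>x. - f x)"

definition p_minus :: "(real \<Rightarrow> real) \<Rightarrow> real set \<Rightarrow> ereal"
  where "p_minus p A = essinf (lebesgue_on A) (\<lambda>x. ereal (p x))"

definition p_plus :: "(real \<Rightarrow> real) \<Rightarrow> real set \<Rightarrow> ereal"
  where "p_plus p A = esssup (lebesgue_on A) (\<lambda>x. ereal (p x))"

text \<open>Only meant for exponents \<open>t > 0\<close>, where \<open>0\<close> and \<open>\<infinity>\<close> are fixed.\<close>

definition ennreal_powr :: "ennreal \<Rightarrow> real \<Rightarrow> ennreal"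
  where "ennreal_powr a t = (if a = \<infinity> then \<infinity> else ennreal (enn2real a powr t))"

text \<open>The quasi-norm is applied to absolute values; these are allowed to be \<open>\<infinity>\<close> because maximal
  functions may be. It is \<open>\<infinity>\<close> if no \<open>c\<close> is admissible.\<close>

definition var_norm :: "(real \<Rightarrow> real) \<Rightarrow> (real \<Rightarrow> ennreal) \<Rightarrow> ennreal"
  where "var_norm p g =
    (INF c\<in>{c::real. c > 0 \<and>
        (\<integral>\<^sup>+x. ennreal_powr (g x / ennreal c) (p x) \<partial>unit_lebesgue) \<le> 1}. ennreal c)"


section \<open>Dyadic martingales\<close>

definition dyadic_intervals :: "nat \<Rightarrow> real set set"
  where "dyadic_intervals n = {{real k / 2 ^ n ..< (real k + 1) / 2 ^ n} | k. k < 2 ^ n}"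

definition dyadic_filtration :: "nat \<Rightarrow> real measure"
  where "dyadic_filtration n = sigma {0..<1} (dyadic_intervals n)"

text \<open>The library's conditional expectation is \<open>0\<close> unless this holds.\<close>

lemma subalgebra_dyadic_filtration: "subalgebra unit_lebesgue (dyadic_filtration n)"
proof -
  have *: "dyadic_intervals n \<subseteq> sets unit_lebesgue"
  proof
    fix A assume "A \<in> dyadic_intervals n"
    then obtain k where k: "k < 2^n" "A = {real k / 2 ^ n ..< (real k + 1) / 2 ^ n}" by (auto simp: dyadic_intervals_def)
    have "real k + 1 \<le> 2^n" using k(1) by (metis Suc_leI add.commute of_nat_Suc of_nat_le_iff of_nat_numeral of_nat_power)
    then have "(real k + 1) / 2 ^ n \<le> 1" by simp
    then have "A \<subseteq> {0..<1}" using k(2) by (auto intro: order_trans[rotated] order.strict_trans2)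
    moreover have "A \<in> sets lebesgue" using k by simp
    ultimately show "A \<in> sets unit_lebesgue" by (subst sets_restrict_space_iff) auto
  qed
  have sp: "space unit_lebesgue = {0..<1}" by simp
  have ps: "dyadic_intervals n \<subseteq> Pow {0..<1}" using * sets.sets_into_space sp by (metis Pow_iff subset_eq)
  show ?thesis unfolding subalgebra_def dyadic_filtration_def using ps * sp
    by (auto simp: space_measure_of sets_measure_of intro: sets.sigma_sets_subset[of _ unit_lebesgue, THEN subsetD, unfolded sp])
qed

definition martingale :: "'a measure \<Rightarrow> (nat \<Rightarrow> 'a measure) \<Rightarrow> (nat \<Rightarrow> 'a \<Rightarrow> real) \<Rightarrow> bool"
  where "martingale M F f \<longleftrightarrow>
    (\<forall>n. f n \<in> borel_measurable (F n) \<and> integrable M (f n)) \<and>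
    (\<forall>m n. m \<le> n \<longrightarrow> (AE x in M. real_cond_exp M (F m) (f n) x = f m x))"

definition maximal_function :: "(nat \<Rightarrow> 'a \<Rightarrow> real) \<Rightarrow> 'a \<Rightarrow> ennreal"
  where "maximal_function f x = (SUP n. ennreal \<bar>f n x\<bar>)"

definition hardy_norm :: "(real \<Rightarrow> real) \<Rightarrow> (nat \<Rightarrow> real \<Rightarrow> real) \<Rightarrow> ennreal"
  where "hardy_norm p f = var_norm p (maximal_function f)"

definition hardy_space :: "(real \<Rightarrow> real) \<Rightarrow> (nat \<Rightarrow> real \<Rightarrow> real) set"
  where "hardy_space p =
    {f. martingale unit_lebesgue dyadic_filtration f \<and> hardy_norm p f < \<infinity>}"


section \<open>Walsh--Fourier series\<close>

definition rademacher :: "nat \<Rightarrow> real \<Rightarrow> real"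
  where "rademacher n x = (if frac (2 ^ n * x) < 1 / 2 then 1 else - 1)"

definition walsh :: "nat \<Rightarrow> real \<Rightarrow> real"
  where "walsh n x = (\<Prod>k\<in>{k. bit n k}. rademacher k x)"

text \<open>Hence the product in \<open>walsh\<close> is a genuine finite product.\<close>

lemma finite_bits: "finite {k. bit (n::nat) k}"
proof (rule finite_subset)
  show "{k. bit n k} \<subseteq> {..<n}"
  proof
    fix k assume "k \<in> {k. bit n k}"
    then have "n div 2 ^ k \<noteq> 0" by (auto simp: bit_iff_odd intro!: odd_pos)
    then have "2 ^ k \<le> n" by (metis div_less linorder_not_less)
    then show "k \<in> {..<n}" using less_le_trans[OF less_exp[of k]] by simp
  qed
qed simp

definition walsh_coeff :: "(nat \<Rightarrow> real \<Rightarrow> real) \<Rightarrow> nat \<Rightarrow> real"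
  where "walsh_coeff f n = lim (\<lambda>k. \<integral>x. f k x * walsh n x \<partial>unit_lebesgue)"

definition walsh_partial_sum :: "nat \<Rightarrow> (nat \<Rightarrow> real \<Rightarrow> real) \<Rightarrow> real \<Rightarrow> real"
  where "walsh_partial_sum n f x = (\<Sum>k<n. walsh_coeff f k * walsh k x)"

definition fejer_mean :: "nat \<Rightarrow> (nat \<Rightarrow> real \<Rightarrow> real) \<Rightarrow> real \<Rightarrow> real"
  where "fejer_mean n f x = (\<Sum>k=1..n. walsh_partial_sum k f x) / real n"

definition maximal_fejer :: "(nat \<Rightarrow> real \<Rightarrow> real) \<Rightarrow> real \<Rightarrow> ennreal"
  where "maximal_fejer f x = (SUP n\<in>{1..}. ennreal \<bar>fejer_mean n f x\<bar>)"

end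

theory Submission
  imports Defs
begin

text \<open>
  Let \<open>G = M(f)\<close>, and for \<open>\<phi>\<close> on \<open>[0,1)\<close> let \<open>E\<^sub>i\<phi>(x)\<close> be the mean of \<open>\<phi>\<close> over the dyadic interval of length \<open>2\<^sup>-\<^sup>i\<close> that contains \<open>x\<close>.
  The proof is a pointwise domination of \<open>\<sigma>\<^sub>* f\<close> by means of \<open>G\<^sup>r\<close> over dyadic translates of the intervals around
  \<open>x\<close>, followed by a maximal inequality for such translates; no atomic decomposition is needed.

  Domination (\<open>abs_fejer_mean_le\<close>). If \<open>n < 2\<^sup>N\<close>, then \<open>n \<sigma>\<^sub>n f\<close> depends only on \<open>f\<^sub>N\<close>. Splitting off the leading
  binary digit \<open>2\<^sup>a\<close> of \<open>n\<close> leaves the sum for the remaining digits, formed with \<open>r\<^sub>a f\<^sub>N\<close> in place of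
  \<open>f\<^sub>N\<close>, besides terms of order \<open>2\<^sup>a\<close> for which the kernel is explicit. As \<open>\<bar>r\<^sub>a f\<^sub>N\<bar> = \<bar>f\<^sub>N\<bar>\<close>, this gives by induction
  (\<open>abs_fejer_sum_le\<close>) \<open>\<bar>n \<sigma>\<^sub>n f(x)\<bar> \<le> \<Sum>\<^bsub>i<N\<^esub> \<Sum>\<^bsub>j\<le>i\<^esub> 2\<^bsup>j+1\<^esup> E\<^sub>i\<bar>f\<^sub>N\<bar>(x\<^sub>j)\<close>, where \<open>x\<^sub>j\<close> arises from \<open>x\<close> by changing one binary digit.
  The lost cancellation is recovered from the fact that \<open>f\<^sub>N\<close> is constant on intervals of length \<open>2\<^sup>-\<^sup>N\<close>: for \<open>0 < r \<le> 1\<close>,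
  \<open>E\<^sub>i\<bar>f\<^sub>N\<bar> \<le> 2\<^bsup>(N-i)(1/r-1)\<^esup> (E\<^sub>i\<bar>f\<^sub>N\<bar>\<^sup>r)\<^bsup>1/r\<^esup>\<close> (\<open>cell_mean_le_powr_mean\<close>). If \<open>r > 1/2\<close>, the loss is less than
  \<open>2\<^bsup>N-i\<^esup>\<close>, and \<open>\<sigma>\<^sub>* f(x)\<close> is bounded by a multiple of the supremum of \<open>b\<^bsup>-k\<^esup> (E\<^sub>i G\<^sup>r(x\<^bsub>i-k\<^esub>))\<^bsup>1/r\<^esup>\<close> over \<open>k \<le> i\<close>, for any \<open>b < 2\<close>.

  Variable exponents (\<open>shifted_means_le\<close>). Let \<open>r < p\<^sub>-\<close> and \<open>1 < q \<le> p\<^sub>-/r\<close>, normalize \<open>\<integral>G\<^sup>p \<le> 1\<close>, and put \<open>u = G\<^bsup>p/q\<^esup>\<close>.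
  With the lower bound of \<open>p\<close> on the common ancestor \<open>A\<close>, of length \<open>2\<^bsup>k-i\<^esup>\<close>, of \<open>x\<close> and \<open>x\<^bsub>i-k\<^esub>\<close>, a Jensen type argument gives
  \<open>(E\<^sub>i G\<^sup>r(x\<^bsub>i-k\<^esub>))\<^bsup>1/r\<^esup> \<le> c (1 + v)\<^bsup>q/p\<^sub>-(A)\<^esup>\<close> with \<open>v = E\<^sub>i u(x\<^bsub>i-k\<^esub>)\<close>. Since \<open>v \<le> 2\<^bsup>i+1\<^esup>\<close>, the regularity of the exponent allows
  \<open>p\<^sub>-(A)\<close> to be replaced by \<open>p(x)\<close> at the price of a factor \<open>c' \<theta>\<^sup>k\<close>, \<open>\<theta> = 2\<^bsup>q(1/p\<^sub>- - 1/p\<^sub>+)\<^esup>\<close>. The hypothesis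
  \<open>1/p\<^sub>- - 1/p\<^sub>+ < 1\<close> says exactly that \<open>\<theta> < b < 2\<close> can be arranged with \<open>q > 1\<close>. After raising to the power \<open>p(x)\<close>
  the terms decay geometrically in \<open>k\<close>, and it remains to integrate \<open>(1 + sup\<^bsub>i\<ge>k\<^esub> E\<^sub>i u(x\<^bsub>i-k\<^esub>))\<^sup>q\<close>.

  Maximal inequality (\<open>shifted_maximal_inequality\<close>). The level sets of the shifted maximal function have at most \<open>k + 1\<close> times the
  measure of those of the dyadic maximal function (\<open>emeasure_shifted_level_set_le\<close>), so the last integral grows at most linearly
  in \<open>k\<close>.
\<close>

section \<open>Dyadic intervals and Walsh functions\<close>

text \<open>The dyadic interval of length \<open>2\<^sup>-\<^sup>i\<close> that contains \<open>x\<close>. It is defined on the whole line, so that no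
  side condition is needed until measures come in; for \<open>x \<in> [0,1)\<close> it is contained in \<open>[0,1)\<close>.\<close>

definition cell :: "nat \<Rightarrow> real \<Rightarrow> real set"
  where "cell i x = {y. \<lfloor>2 ^ i * y\<rfloor> = \<lfloor>2 ^ i * x\<rfloor>}"

text \<open>Dyadic translation by \<open>2\<^sup>-\<^sup>j\<^sup>-\<^sup>1\<close>: the binary digit of \<open>x\<close> to which \<open>rademacher j\<close> refers is changed.\<close>

definition flip :: "nat \<Rightarrow> real \<Rightarrow> real"
  where "flip j x = x + rademacher j x / 2 ^ (j + 1)"

lemma floor_pow2_div:
  fixes y :: real
  assumes "i \<le> j"
  shows "\<lfloor>2 ^ i * y\<rfloor> = \<lfloor>2 ^ j * y\<rfloor> div 2 ^ (j - i)"
proof -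
  have "2 ^ i * y = 2 ^ j * y / real_of_int (2 ^ (j - i))"
    using assms by (simp add: field_simps flip: power_add)
  then show ?thesis
    by (metis floor_divide_real_eq_div zero_le_numeral zero_le_power)
qed

lemma cell_refl [simp]: "x \<in> cell i x"
  by (simp add: cell_def)

lemma cell_cong: "y \<in> cell i x \<Longrightarrow> cell i y = cell i x"
  by (simp add: cell_def)

lemma cell_antimono: "i \<le> j \<Longrightarrow> cell j x \<subseteq> cell i x"
  using floor_pow2_div by (auto simp: cell_def)

lemma cell_eq: "cell i x = {of_int \<lfloor>2 ^ i * x\<rfloor> / 2 ^ i ..< (of_int \<lfloor>2 ^ i * x\<rfloor> + 1) / 2 ^ i}"
  by (auto simp: cell_def floor_eq_iff field_simps)

lemma cell_in_dyadic_intervals: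
  assumes "x \<in> {0..<1}"
  shows "cell i x \<in> dyadic_intervals i"
proof -
  have "0 \<le> \<lfloor>2 ^ i * x\<rfloor>" using assms by simp
  moreover have "2 ^ i * x < 2 ^ i * 1" using assms by (intro mult_strict_left_mono) auto
  then have "\<lfloor>2 ^ i * x\<rfloor> < 2 ^ i" by (simp add: floor_less_iff)
  ultimately obtain k :: nat where k: "\<lfloor>2 ^ i * x\<rfloor> = int k" "k < 2 ^ i"
    by (metis nonneg_int_cases of_nat_less_iff of_nat_numeral of_nat_power)
  then show ?thesis
    by (auto simp: cell_eq dyadic_intervals_def intro!: exI[of _ k])
qed

lemma dyadic_interval_eq_cell:
  assumes "A \<in> dyadic_intervals i" "x \<in> A"
  shows "A = cell i x" "x \<in> {0..<1}"
proof -
  obtain k where k: "k < 2 ^ i" "A = {real k / 2 ^ i ..< (real k + 1) / 2 ^ i}"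
    using assms by (auto simp: dyadic_intervals_def)
  have "\<lfloor>2 ^ i * x\<rfloor> = int k"
    using assms(2) k by (auto simp: floor_eq_iff field_simps)
  then show "A = cell i x"
    using k by (simp add: cell_eq)
  have "real (k + 1) \<le> real (2 ^ i)" using k(1) by (subst of_nat_le_iff) simp
  then have "(real k + 1) / 2 ^ i \<le> 1" by simp
  moreover have "0 \<le> real k / 2 ^ i" by simp
  moreover have "real k / 2 ^ i \<le> x" "x < (real k + 1) / 2 ^ i" using assms(2) k(2) by auto
  ultimately have "0 \<le> x" "x < 1" by linarith+
  then show "x \<in> {0..<1}" by simp
qed

lemma cell_subset_unit: "x \<in> {0..<1} \<Longrightarrow> cell i x \<subseteq> {0..<1}"
  using cell_in_dyadic_intervals dyadic_interval_eq_cell(2) by blast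

lemma rademacher_floor: "rademacher k x = (if even \<lfloor>2 ^ Suc k * x\<rfloor> then 1 else - 1)"
proof -
  define z where "z = 2 ^ k * x"
  have z: "2 ^ Suc k * x = 2 * z" by (simp add: z_def)
  have "frac z < 1 / 2 \<longleftrightarrow> even \<lfloor>2 * z\<rfloor>"
  proof (cases "frac z < 1 / 2")
    case True
    have "\<lfloor>2 * z\<rfloor> = 2 * \<lfloor>z\<rfloor>"
      using True frac_ge_0[of z] unfolding frac_def by (simp add: floor_eq_iff)
    then show ?thesis using True by simp
  next
    case False
    have "\<lfloor>2 * z\<rfloor> = 2 * \<lfloor>z\<rfloor> + 1"
      using False frac_lt_1[of z] unfolding frac_def by (simp add: floor_eq_iff)
    then show ?thesis using False by simp
  qed
  then show ?thesis by (simp add: rademacher_def z[symmetric] flip: z_def)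
qed

lemma rademacher_cases: "rademacher k x = 1 \<or> rademacher k x = - 1"
  by (simp add: rademacher_def)

lemma abs_rademacher [simp]: "\<bar>rademacher k x\<bar> = 1"
  by (simp add: rademacher_def)

lemma rademacher_sq [simp]: "rademacher k x * rademacher k x = 1"
  by (simp add: rademacher_def)

lemma rademacher_cong_cell: "y \<in> cell i x \<Longrightarrow> k < i \<Longrightarrow> rademacher k y = rademacher k x"
  using floor_pow2_div[of "Suc k" i] by (simp add: rademacher_floor cell_def)

text \<open>Halving a cell: the two halves are told apart by the sign of the next Rademacher function.\<close>

lemma mem_cell_Suc: "t \<in> cell (Suc a) y \<longleftrightarrow> t \<in> cell a y \<and> rademacher a t = rademacher a y"
proof
  assume "t \<in> cell (Suc a) y"
  then show "t \<in> cell a y \<and> rademacher a t = rademacher a y"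
    using cell_antimono[of a "Suc a" y] rademacher_cong_cell[of t "Suc a" y a] by auto
next
  assume *: "t \<in> cell a y \<and> rademacher a t = rademacher a y"
  have "\<lfloor>2 ^ a * t\<rfloor> = \<lfloor>2 ^ Suc a * t\<rfloor> div 2" "\<lfloor>2 ^ a * y\<rfloor> = \<lfloor>2 ^ Suc a * y\<rfloor> div 2"
    using floor_pow2_div[of a "Suc a"] by simp_all
  then have d: "\<lfloor>2 ^ Suc a * t\<rfloor> div 2 = \<lfloor>2 ^ Suc a * y\<rfloor> div 2"
    using * unfolding cell_def mem_Collect_eq by metis
  have e: "even \<lfloor>2 ^ Suc a * t\<rfloor> = even \<lfloor>2 ^ Suc a * y\<rfloor>"
    using * by (auto simp: rademacher_floor split: if_splits)
  have "m = n" if "m div 2 = n div 2" "even m = even n" for m n :: int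
    using that by presburger
  then have "\<lfloor>2 ^ Suc a * t\<rfloor> = \<lfloor>2 ^ Suc a * y\<rfloor>"
    using d e by blast
  then show "t \<in> cell (Suc a) y" by (simp add: cell_def)
qed

lemma flip_in_cell:
  assumes "i \<le> j"
  shows "flip j x \<in> cell i x"
proof -
  have "\<lfloor>2 ^ j * flip j x\<rfloor> = \<lfloor>2 ^ j * x\<rfloor>"
  proof -
    define z where "z = 2 ^ j * x"
    have e: "2 ^ j * flip j x = z + (if frac z < 1 / 2 then 1 / 2 else - 1 / 2)"
      by (simp add: flip_def rademacher_def z_def distrib_left)
    have "\<lfloor>2 ^ j * flip j x\<rfloor> = \<lfloor>z\<rfloor>"
      unfolding e frac_def floor_eq_iff using of_int_floor_le[of z] floor_less_cancel[of z]
      by (cases "z - of_int \<lfloor>z\<rfloor> < 1 / 2") (simp_all, linarith+)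
    then show ?thesis by (simp add: z_def)
  qed
  then have "flip j x \<in> cell j x" by (simp add: cell_def)
  then show ?thesis using cell_antimono[OF assms] by blast
qed

lemma cell_flip: "i \<le> j \<Longrightarrow> cell i (flip j x) = cell i x"
  by (rule cell_cong) (rule flip_in_cell)

lemma flip_in_unit: "x \<in> {0..<1} \<Longrightarrow> flip j x \<in> {0..<1}"
  using flip_in_cell[of 0 j x] cell_subset_unit[of x 0] by blast

lemma rademacher_flip_lower:
  assumes "j < a"
  shows "rademacher a (flip j x) = rademacher a x"
proof -
  have "2 ^ a = (2::real) ^ (a - Suc j) * 2 ^ (j + 1)" using assms
    by (subst power_add[symmetric]) simp
  then have "2 ^ a * flip j x = 2 ^ a * x + rademacher j x * 2 ^ (a - Suc j)"
    by (simp add: flip_def field_simps)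
  also have "\<dots> = 2 ^ a * x + of_int (if rademacher j x = 1 then 2 ^ (a - Suc j) else - (2 ^ (a - Suc j)))"
    using rademacher_cases[of j x] by auto
  finally show ?thesis
    unfolding rademacher_def frac_def by (simp only: floor_add_int[symmetric]) simp
qed

lemma rademacher_flip_same: "rademacher j (flip j x) = - rademacher j x"
proof -
  have "2 ^ Suc j * flip j x = 2 ^ Suc j * x + of_int (if rademacher j x = 1 then 1 else - 1)"
    using rademacher_cases[of j x] by (auto simp: flip_def distrib_left)
  then have "\<lfloor>2 ^ Suc j * flip j x\<rfloor> = \<lfloor>2 ^ Suc j * x\<rfloor> + (if rademacher j x = 1 then 1 else - 1)"
    by (simp only: floor_add_int[symmetric])
  then show ?thesis
    unfolding rademacher_floor by (auto split: if_splits)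
qed

lemma flip_flip: "flip j (flip j x) = x"
  unfolding flip_def[of j "flip j x"] rademacher_flip_same by (simp add: flip_def)

lemma cell_borel [measurable]: "cell i x \<in> sets borel"
  by (simp add: cell_eq)

lemma rademacher_measurable [measurable]: "rademacher k \<in> borel_measurable borel"
  unfolding rademacher_floor by measurable

lemma flip_measurable [measurable]: "flip j \<in> borel_measurable borel"
  unfolding flip_def by measurable

lemma borel_measurable_unit: "f \<in> borel_measurable borel \<Longrightarrow> f \<in> borel_measurable unit_lebesgue"
  by (simp add: measurable_completion measurable_restrict_space1)

lemma cell_unit_sets [measurable]: "x \<in> {0..<1} \<Longrightarrow> cell i x \<in> sets unit_lebesgue"
  using cell_subset_unit[of x i] by (auto simp: sets_restrict_space_iff)

lemma emeasure_cell: "x \<in> {0..<1} \<Longrightarrow> emeasure unit_lebesgue (cell i x) = ennreal (1 / 2 ^ i)"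
  using cell_subset_unit[of x i]
  by (subst emeasure_restrict_space) (auto simp: cell_eq diff_divide_distrib[symmetric] divide_right_mono)

lemma walsh_measurable [measurable]: "walsh n \<in> borel_measurable borel"
  unfolding walsh_def by measurable

lemma abs_walsh [simp]: "\<bar>walsh n x\<bar> = 1"
  by (simp add: walsh_def abs_prod)

lemma walsh_add:
  assumes "l < 2 ^ a"
  shows "walsh (2 ^ a + l) x = rademacher a x * walsh l x"
proof -
  have nb: "\<not> bit l a" using assms by (simp add: bit_iff_odd)
  have "bit (2 ^ a + l) k \<longleftrightarrow> k = a \<or> bit l k" for k
  proof -
    have "2 ^ a + l = or (2 ^ a) l"
      by (rule disjunctive_add) (use nb in \<open>auto simp: bit_exp_iff\<close>)
    then show ?thesis by (auto simp: bit_or_iff bit_exp_iff)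
  qed
  then have "{k. bit (2 ^ a + l) k} = insert a {k. bit l k}" by auto
  then show ?thesis
    using nb by (simp add: walsh_def finite_bits)
qed

lemma walsh_cong_cell:
  assumes "y \<in> cell N x" "l < 2 ^ N"
  shows "walsh l y = walsh l x"
proof -
  have "k < N" if "bit l k" for k
  proof (rule ccontr)
    assume "\<not> k < N"
    then have "(2::nat) ^ N \<le> 2 ^ k" by simp
    then have "l < 2 ^ k" using assms(2) by linarith
    then show False using that by (simp add: bit_iff_odd)
  qed
  then show ?thesis
    unfolding walsh_def using rademacher_cong_cell[OF assms(1)] by (intro prod.cong) auto
qed

section \<open>Fejer sums of integrable functions\<close>

text \<open>The conditional expectation of \<open>\<phi>\<close> at level \<open>i\<close>, as a function that is defined everywhere. The factor is
  \<open>2\<^sup>i\<close> also outside \<open>[0,1)\<close>, where the value has no meaning.\<close>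

definition cell_mean :: "nat \<Rightarrow> (real \<Rightarrow> real) \<Rightarrow> real \<Rightarrow> real"
  where "cell_mean i \<phi> x = 2 ^ i * (\<integral>t. indicator (cell i x) t * \<phi> t \<partial>unit_lebesgue)"

lemma integrable_mult_bounded:
  fixes \<phi> g :: "real \<Rightarrow> real"
  assumes "integrable M \<phi>" "g \<in> borel_measurable M" "\<And>x. \<bar>g x\<bar> \<le> 1"
  shows "integrable M (\<lambda>x. g x * \<phi> x)"
proof (rule Bochner_Integration.integrable_bound[OF assms(1)])
  show "(\<lambda>x. g x * \<phi> x) \<in> borel_measurable M"
    using assms by (auto intro: borel_measurable_times)
  show "AE x in M. norm (g x * \<phi> x) \<le> norm (\<phi> x)"
    using assms(3) by (auto simp: abs_mult mult_left_le_one_le)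
qed

lemma integrable_indicator_cell:
  fixes \<phi> :: "real \<Rightarrow> real"
  assumes "integrable unit_lebesgue \<phi>"
  shows "integrable unit_lebesgue (\<lambda>t. indicator (cell i x) t * \<phi> t)"
  by (rule integrable_mult_bounded[OF assms borel_measurable_unit]) (auto simp: indicator_def)

lemma integrable_rademacher_mult:
  fixes \<phi> :: "real \<Rightarrow> real"
  assumes "integrable unit_lebesgue \<phi>"
  shows "integrable unit_lebesgue (\<lambda>t. rademacher a t * \<phi> t)"
  by (rule integrable_mult_bounded[OF assms borel_measurable_unit]) auto

lemma integrable_walsh_mult:
  fixes \<phi> :: "real \<Rightarrow> real"
  assumes "integrable unit_lebesgue \<phi>"
  shows "integrable unit_lebesgue (\<lambda>t. walsh l t * \<phi> t)"
  by (rule integrable_mult_bounded[OF assms borel_measurable_unit]) auto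

lemma cell_mean_cong_cell: "y \<in> cell i x \<Longrightarrow> cell_mean i \<phi> y = cell_mean i \<phi> x"
  by (simp add: cell_mean_def cell_cong)

lemma cell_mean_mono:
  assumes "integrable unit_lebesgue \<phi>" "integrable unit_lebesgue \<psi>"
    and "AE t in unit_lebesgue. t \<in> cell i x \<longrightarrow> \<phi> t \<le> \<psi> t"
  shows "cell_mean i \<phi> x \<le> cell_mean i \<psi> x"
  unfolding cell_mean_def using assms(3)
  by (intro mult_left_mono integral_mono_AE integrable_indicator_cell assms(1,2))
     (auto simp: indicator_def)

lemma cell_mean_nonneg: "(\<And>t. 0 \<le> \<phi> t) \<Longrightarrow> 0 \<le> cell_mean i \<phi> x"
  unfolding cell_mean_def by (intro mult_nonneg_nonneg integral_nonneg_AE) auto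

lemma cell_mean_cmult: "cell_mean i (\<lambda>t. c * \<phi> t) x = c * cell_mean i \<phi> x"
proof -
  have "(\<integral>t. indicator (cell i x) t * (c * \<phi> t) \<partial>unit_lebesgue)
      = (\<integral>t. c * (indicator (cell i x) t * \<phi> t) \<partial>unit_lebesgue)"
    by (intro Bochner_Integration.integral_cong) auto
  then show ?thesis by (simp add: cell_mean_def)
qed

lemma cell_mean_add:
  assumes "integrable unit_lebesgue \<phi>" "integrable unit_lebesgue \<psi>"
  shows "cell_mean i (\<lambda>t. \<phi> t + \<psi> t) x = cell_mean i \<phi> x + cell_mean i \<psi> x"
  using assms[THEN integrable_indicator_cell, of i x]
  by (simp add: cell_mean_def distrib_left)

lemma integrable_const_unit: "integrable unit_lebesgue (\<lambda>_. c :: real)"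
proof -
  have "finite_measure unit_lebesgue"
    by (rule finite_measureI) (simp add: emeasure_restrict_space)
  then show ?thesis by (simp add: finite_measure.integrable_const)
qed

lemma cell_mean_const:
  assumes "x \<in> {0..<1}"
  shows "cell_mean i (\<lambda>_. c) x = c"
proof -
  have "measure unit_lebesgue (cell i x) = 1 / 2 ^ i"
    using emeasure_cell[OF assms] by (simp add: measure_def)
  moreover have "cell i x \<inter> {0..<1} = cell i x" using cell_subset_unit[OF assms] by auto
  ultimately show ?thesis by (simp add: cell_mean_def)
qed

lemma abs_cell_mean_le:
  assumes "integrable unit_lebesgue \<phi>"
  shows "\<bar>cell_mean i \<phi> x\<bar> \<le> cell_mean i (\<lambda>t. \<bar>\<phi> t\<bar>) x"
proof -
  have "\<bar>\<integral>t. indicator (cell i x) t * \<phi> t \<partial>unit_lebesgue\<bar> \<le> (\<integral>t. \<bar>indicator (cell i x) t * \<phi> t\<bar> \<partial>unit_lebesgue)"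
    by (rule integral_abs_bound)
  also have "\<dots> = (\<integral>t. indicator (cell i x) t * \<bar>\<phi> t\<bar> \<partial>unit_lebesgue)"
    by (intro Bochner_Integration.integral_cong) (auto simp: abs_mult)
  finally show ?thesis
    unfolding cell_mean_def abs_mult by (intro mult_mono) auto
qed

lemma cell_mean_le_coarser:
  assumes "integrable unit_lebesgue \<phi>" "\<And>t. 0 \<le> \<phi> t" "i \<le> N"
  shows "cell_mean N \<phi> x \<le> 2 ^ (N - i) * cell_mean i \<phi> x"
proof -
  have "(\<integral>t. indicator (cell N x) t * \<phi> t \<partial>unit_lebesgue) \<le> (\<integral>t. indicator (cell i x) t * \<phi> t \<partial>unit_lebesgue)"
    using cell_antimono[OF assms(3), of x] assms(2)
    by (intro integral_mono integrable_indicator_cell assms(1)) (auto simp: indicator_def)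
  moreover have "(2::real) ^ N = 2 ^ (N - i) * 2 ^ i" using assms(3) by (subst power_add[symmetric]) simp
  ultimately show ?thesis by (simp add: cell_mean_def)
qed

text \<open>Passing from one scale to the next: for \<open>t \<in> cell a y\<close>, \<open>1 + r\<^sub>a(y) r\<^sub>a(t)\<close> is twice the indicator of the
  half of the cell that contains \<open>y\<close>.\<close>

lemma cell_mean_Suc:
  assumes "integrable unit_lebesgue \<phi>"
  shows "cell_mean (Suc a) \<phi> y
       = cell_mean a \<phi> y + rademacher a y * cell_mean a (\<lambda>t. rademacher a t * \<phi> t) y"
proof -
  have "2 * (indicator (cell (Suc a) y) t * \<phi> t)
      = indicator (cell a y) t * \<phi> t + rademacher a y * (indicator (cell a y) t * (rademacher a t * \<phi> t))" for t
    using mem_cell_Suc[of t a y] rademacher_cases[of a t] rademacher_cases[of a y]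
    by (auto simp: indicator_def)
  then have "(\<integral>t. 2 * (indicator (cell (Suc a) y) t * \<phi> t) \<partial>unit_lebesgue)
      = (\<integral>t. indicator (cell a y) t * \<phi> t \<partial>unit_lebesgue)
        + (\<integral>t. rademacher a y * (indicator (cell a y) t * (rademacher a t * \<phi> t)) \<partial>unit_lebesgue)"
    using assms
    by (subst Bochner_Integration.integral_add[symmetric])
       (auto intro!: integrable_mult_right integrable_indicator_cell integrable_rademacher_mult)
  moreover have *: "2 * p * S = p * A + r * (p * R)" if "2 * S = A + r * R" for S A r R p :: real
    using that by algebra
  ultimately show ?thesis
    unfolding cell_mean_def power_Suc integral_mult_right_zero by (intro *)
qed

lemma cell_mean_halves:
  assumes "integrable unit_lebesgue \<phi>"
  shows "2 * cell_mean a \<phi> x = cell_mean (Suc a) \<phi> x + cell_mean (Suc a) \<phi> (flip a x)"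
  unfolding cell_mean_Suc[OF assms] rademacher_flip_same
  using cell_mean_cong_cell[OF flip_in_cell[OF order_refl]] by simp

text \<open>The Walsh--Fourier coefficients of a function.\<close>

definition walsh_inner :: "(real \<Rightarrow> real) \<Rightarrow> nat \<Rightarrow> real"
  where "walsh_inner \<phi> l = (\<integral>t. walsh l t * \<phi> t \<partial>unit_lebesgue)"

lemma walsh_inner_add:
  assumes "l < 2 ^ a"
  shows "walsh_inner \<phi> (2 ^ a + l) = walsh_inner (\<lambda>t. rademacher a t * \<phi> t) l"
  unfolding walsh_inner_def walsh_add[OF assms]
  by (intro Bochner_Integration.integral_cong) auto

lemma sum_split_pow2:
  fixes F :: "nat \<Rightarrow> real"
  shows "(\<Sum>l<2 ^ a + m. F l) = (\<Sum>l<2 ^ a. F l) + (\<Sum>l<m. F (2 ^ a + l))"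
  by (induction m) auto

text \<open>The Walsh partial sums of order \<open>2\<^sup>a\<close> are the conditional expectations.\<close>

lemma walsh_sum_pow2:
  assumes "integrable unit_lebesgue \<phi>" "x \<in> {0..<1}"
  shows "(\<Sum>l<2 ^ a. walsh_inner \<phi> l * walsh l x) = cell_mean a \<phi> x"
  using assms(1)
proof (induction a arbitrary: \<phi>)
  case 0
  have "indicator (cell 0 x) t * \<phi> t = walsh 0 t * \<phi> t" if "t \<in> {0..<1}" for t
  proof -
    have "\<lfloor>t\<rfloor> = 0" "\<lfloor>x\<rfloor> = 0" using that assms(2) by (simp_all add: floor_eq_iff)
    then show ?thesis by (simp add: cell_def walsh_def)
  qed
  then have "(\<integral>t. indicator (cell 0 x) t * \<phi> t \<partial>unit_lebesgue) = walsh_inner \<phi> 0"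
    unfolding walsh_inner_def by (intro Bochner_Integration.integral_cong) auto
  then show ?case
    by (simp add: cell_mean_def walsh_def)
next
  case (Suc a)
  have "(\<Sum>l<2 ^ Suc a. walsh_inner \<phi> l * walsh l x)
      = (\<Sum>l<2 ^ a. walsh_inner \<phi> l * walsh l x) + (\<Sum>l<2 ^ a. walsh_inner \<phi> (2 ^ a + l) * walsh (2 ^ a + l) x)"
    by (simp add: mult_2 sum_split_pow2)
  also have "(\<Sum>l<2 ^ a. walsh_inner \<phi> (2 ^ a + l) * walsh (2 ^ a + l) x)
      = rademacher a x * (\<Sum>l<2 ^ a. walsh_inner (\<lambda>t. rademacher a t * \<phi> t) l * walsh l x)"
    unfolding sum_distrib_left by (intro sum.cong) (auto simp: walsh_inner_add walsh_add)
  finally show ?case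
    using Suc.IH[OF Suc.prems] Suc.IH[OF integrable_rademacher_mult[OF Suc.prems]]
    by (simp add: cell_mean_Suc[OF Suc.prems])
qed

text \<open>The Fejer mean of order \<open>n\<close> of a function, multiplied by \<open>n\<close>. Without the denominator, splitting off the
  leading binary digit of \<open>n\<close> is an identity.\<close>

definition fejer_sum :: "nat \<Rightarrow> (real \<Rightarrow> real) \<Rightarrow> real \<Rightarrow> real"
  where "fejer_sum n \<phi> x = (\<Sum>l<n. (real n - real l) * (walsh_inner \<phi> l * walsh l x))"

lemma fejer_sum_split:
  assumes "integrable unit_lebesgue \<phi>" "x \<in> {0..<1}" "m \<le> 2 ^ a"
  shows "fejer_sum (2 ^ a + m) \<phi> x = fejer_sum (2 ^ a) \<phi> x + real m * cell_mean a \<phi> x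
           + rademacher a x * fejer_sum m (\<lambda>t. rademacher a t * \<phi> t) x"
proof -
  have "fejer_sum (2 ^ a + m) \<phi> x
      = (\<Sum>l<2 ^ a. (real (2 ^ a + m) - real l) * (walsh_inner \<phi> l * walsh l x))
        + (\<Sum>l<m. (real (2 ^ a + m) - real (2 ^ a + l)) * (walsh_inner \<phi> (2 ^ a + l) * walsh (2 ^ a + l) x))"
    by (simp only: fejer_sum_def sum_split_pow2)
  also have "(\<Sum>l<2 ^ a. (real (2 ^ a + m) - real l) * (walsh_inner \<phi> l * walsh l x))
      = fejer_sum (2 ^ a) \<phi> x + real m * cell_mean a \<phi> x"
    unfolding walsh_sum_pow2[OF assms(1,2), symmetric] fejer_sum_def sum_distrib_left sum.distrib[symmetric]
    by (intro sum.cong) (auto simp: algebra_simps)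
  also have "(\<Sum>l<m. (real (2 ^ a + m) - real (2 ^ a + l)) * (walsh_inner \<phi> (2 ^ a + l) * walsh (2 ^ a + l) x))
      = rademacher a x * fejer_sum m (\<lambda>t. rademacher a t * \<phi> t) x"
    unfolding fejer_sum_def sum_distrib_left
    by (intro sum.cong) (use assms(3) in \<open>auto simp: walsh_inner_add walsh_add\<close>)
  finally show ?thesis .
qed

text \<open>For powers of \<open>2\<close> the Fejer kernel is explicit. Adding the identity at level \<open>a\<close> for \<open>\<phi>\<close> to \<open>r\<^sub>a(x)\<close> times the one
  for \<open>r\<^sub>a \<phi>\<close> refines all means to level \<open>a + 1\<close>; the remaining mean over the parent cell
  produces the new summand \<open>j = a\<close>.\<close>

lemma fejer_sum_pow2:
  assumes "integrable unit_lebesgue \<phi>" "x \<in> {0..<1}"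
  shows "fejer_sum (2 ^ a) \<phi> x
       = (2 ^ a + 1) / 2 * cell_mean a \<phi> x + (\<Sum>j<a. 2 ^ j / 2 * cell_mean a \<phi> (flip j x))"
  using assms(1)
proof (induction a arbitrary: \<phi>)
  case 0
  show ?case
    using walsh_sum_pow2[OF 0 assms(2), of 0] by (simp add: fejer_sum_def)
next
  case (Suc a)
  let ?\<psi> = "\<lambda>t. rademacher a t * \<phi> t"
  have *: "cell_mean (Suc a) \<phi> (flip j x) = cell_mean a \<phi> (flip j x) + rademacher a x * cell_mean a ?\<psi> (flip j x)"
    if "j < a" for j
    using cell_mean_Suc[OF Suc.prems, of a "flip j x"] rademacher_flip_lower[OF that, of x] by simp
  have "(\<Sum>j<a. 2 ^ j / 2 * cell_mean (Suc a) \<phi> (flip j x))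
      = (\<Sum>j<a. 2 ^ j / 2 * cell_mean a \<phi> (flip j x)) + rademacher a x * (\<Sum>j<a. 2 ^ j / 2 * cell_mean a ?\<psi> (flip j x))"
    unfolding sum_distrib_left sum.distrib[symmetric]
  proof (intro sum.cong refl)
    fix j assume "j \<in> {..<a}"
    then have "j < a" by simp
    have "c * A = c * B + r * (c * C)" if "A = B + r * C" for A B C c r :: real
      using that by algebra
    from this[OF *[OF \<open>j < a\<close>]]
    show "2 ^ j / 2 * cell_mean (Suc a) \<phi> (flip j x)
        = 2 ^ j / 2 * cell_mean a \<phi> (flip j x) + rademacher a x * (2 ^ j / 2 * cell_mean a ?\<psi> (flip j x))" .
  qed
  moreover have "(P + 1) / 2 * A + S\<^sub>1 + P * A + r * ((P + 1) / 2 * B + S\<^sub>2) = (2 * P + 1) / 2 * E + (S + P / 2 * E')"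
    if "E = A + r * B" "2 * A = E + E'" "S = S\<^sub>1 + r * S\<^sub>2" for P A B r S\<^sub>1 S\<^sub>2 S E E' :: real
  proof -
    have "P * A = P * ((E + E') / 2)" using that by simp
    then show ?thesis using that by (simp add: algebra_simps add_divide_distrib)
  qed
  note arith = this
  ultimately show ?case
    using fejer_sum_split[OF Suc.prems assms(2) order_refl, of a]
    unfolding Suc.IH[OF Suc.prems] Suc.IH[OF integrable_rademacher_mult[OF Suc.prems]]
      mult_2[symmetric] power_Suc[symmetric] sum.lessThan_Suc
    using arith[OF cell_mean_Suc[OF Suc.prems, of a x] cell_mean_halves[OF Suc.prems, of a x], of _ _ _ "2 ^ a"]
    by simp
qed

text \<open>The pointwise estimate for arbitrary \<open>n\<close>. It involves \<open>\<phi>\<close> only through \<open>\<bar>\<phi>\<bar>\<close>, because splitting off binary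
  digits of \<open>n\<close> merely multiplies \<open>\<phi>\<close> by Rademacher functions. The summand \<open>j = i\<close> is the mean over the
  cell of \<open>x\<close> itself.\<close>

lemma abs_fejer_sum_le:
  assumes "integrable unit_lebesgue \<phi>" "x \<in> {0..<1}" "n < 2 ^ N"
  shows "\<bar>fejer_sum n \<phi> x\<bar> \<le> (\<Sum>i<N. \<Sum>j\<le>i. 2 ^ Suc j * cell_mean i (\<lambda>t. \<bar>\<phi> t\<bar>) (flip j x))"
  using assms(1,3)
proof (induction N arbitrary: n \<phi>)
  case 0
  then show ?case by (simp add: fejer_sum_def)
next
  case (Suc N)
  let ?E = "\<lambda>i y. cell_mean i (\<lambda>t. \<bar>\<phi> t\<bar>) y"
  let ?W = "\<Sum>j\<le>N. 2 ^ Suc j * ?E N (flip j x)"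
  have E0: "0 \<le> ?E i y" for i y by (rule cell_mean_nonneg) simp
  have W0: "0 \<le> ?W" using E0 by (intro sum_nonneg) auto
  show ?case
  proof (cases "n < 2 ^ N")
    case True
    then show ?thesis using Suc.IH[OF Suc.prems(1) True] W0 by simp
  next
    case False
    then obtain m where m: "n = 2 ^ N + m" by (metis add_diff_inverse_nat)
    with Suc.prems have mN: "m < 2 ^ N" by simp
    let ?\<psi> = "\<lambda>t. rademacher N t * \<phi> t"
    have split: "fejer_sum n \<phi> x = (2 ^ N + 1) / 2 * cell_mean N \<phi> x + (\<Sum>j<N. 2 ^ j / 2 * cell_mean N \<phi> (flip j x))
         + real m * cell_mean N \<phi> x + rademacher N x * fejer_sum m ?\<psi> x"
      unfolding m using fejer_sum_split[OF Suc.prems(1) assms(2), of m N] mN fejer_sum_pow2[OF Suc.prems(1) assms(2)]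
      by simp
    have b: "\<bar>cell_mean N \<phi> y\<bar> \<le> ?E N y" for y by (rule abs_cell_mean_le[OF Suc.prems(1)])
    have "\<bar>(2 ^ N + 1) / 2 * cell_mean N \<phi> x\<bar> \<le> (2 ^ N + 1) / 2 * ?E N x"
      using b[of x] unfolding abs_mult by (intro mult_mono) auto
    moreover have "\<bar>real m * cell_mean N \<phi> x\<bar> \<le> (2 ^ N - 1) * ?E N x"
    proof -
      have "real (m + 1) \<le> real (2 ^ N)" using mN by (subst of_nat_le_iff) simp
      then show ?thesis using b[of x] unfolding abs_mult by (intro mult_mono) auto
    qed
    moreover have "\<bar>\<Sum>j<N. 2 ^ j / 2 * cell_mean N \<phi> (flip j x)\<bar> \<le> (\<Sum>j<N. 2 ^ Suc j * ?E N (flip j x))"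
    proof -
      have "\<bar>\<Sum>j<N. 2 ^ j / 2 * cell_mean N \<phi> (flip j x)\<bar> \<le> (\<Sum>j<N. \<bar>2 ^ j / 2 * cell_mean N \<phi> (flip j x)\<bar>)"
        by (rule sum_abs)
      also have "\<dots> \<le> (\<Sum>j<N. 2 ^ Suc j * ?E N (flip j x))"
        unfolding abs_mult by (intro sum_mono mult_mono b) auto
      finally show ?thesis .
    qed
    moreover have "\<bar>rademacher N x * fejer_sum m ?\<psi> x\<bar> \<le> (\<Sum>i<N. \<Sum>j\<le>i. 2 ^ Suc j * ?E i (flip j x))"
      using Suc.IH[OF integrable_rademacher_mult[OF Suc.prems(1)] mN] by (simp add: abs_mult)
    moreover have "(2 ^ N + 1) / 2 * ?E N x + (2 ^ N - 1) * ?E N x \<le> 2 ^ Suc N * ?E N x"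
      unfolding distrib_right[symmetric] using E0[of N x] by (intro mult_right_mono) (auto simp: field_simps)
    moreover have "?E N (flip N x) = ?E N x"
      by (rule cell_mean_cong_cell) (simp add: flip_in_cell)
    ultimately show ?thesis
      unfolding split by (simp add: lessThan_Suc_atMost[symmetric])
  qed
qed

section \<open>Pointwise domination of the Fejer means of a martingale\<close>

lemma dyadic_intervals_subset: "dyadic_intervals N \<subseteq> Pow {0..<1}"
  using dyadic_interval_eq_cell(2) by blast

lemma space_dyadic_filtration [simp]: "space (dyadic_filtration N) = {0..<1}"
  by (simp add: dyadic_filtration_def space_measure_of[OF dyadic_intervals_subset])

lemma sets_dyadic_filtration: "sets (dyadic_filtration N) = sigma_sets {0..<1} (dyadic_intervals N)"
  by (simp add: dyadic_filtration_def sets_measure_of[OF dyadic_intervals_subset])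

text \<open>The sets of the \<open>N\<close>-th dyadic \<open>\<sigma>\<close>-algebra are unions of cells.\<close>

lemma dyadic_filtration_set_cell:
  assumes "B \<in> sets (dyadic_filtration N)" "x \<in> {0..<1}" "y \<in> {0..<1}" "y \<in> cell N x"
  shows "x \<in> B \<longleftrightarrow> y \<in> B"
  using assms(1) unfolding sets_dyadic_filtration
proof (induction rule: sigma_sets.induct)
  case (Basic A)
  have "cell N x = cell N y" using cell_cong[OF assms(4)] by simp
  then show ?case
    using dyadic_interval_eq_cell(1)[OF Basic] assms(4) cell_refl by blast
next
  case (Compl A)
  then show ?case using assms(2,3) by simp
qed auto

lemma dyadic_measurable_const_cell:
  fixes h :: "real \<Rightarrow> real"
  assumes "h \<in> borel_measurable (dyadic_filtration N)" "x \<in> {0..<1}" "y \<in> cell N x"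
  shows "h y = h x"
proof -
  have y: "y \<in> {0..<1}" using cell_subset_unit[OF assms(2)] assms(3) by blast
  have "h -` {h x} \<inter> space (dyadic_filtration N) \<in> sets (dyadic_filtration N)"
    by (rule measurable_sets[OF assms(1)]) simp
  from dyadic_filtration_set_cell[OF this assms(2) y assms(3)] show ?thesis
    using assms(2) y by simp
qed

lemma const_cell_dyadic_measurable:
  fixes h :: "real \<Rightarrow> real"
  assumes "\<And>x y. y \<in> cell N x \<Longrightarrow> h y = h x"
  shows "h \<in> borel_measurable (dyadic_filtration N)"
proof -
  have "h y = h (of_int \<lfloor>2 ^ N * y\<rfloor> / 2 ^ N)" for y
    by (rule assms) (simp add: cell_def)
  then have h: "h = (\<lambda>m. h (of_int m / 2 ^ N)) \<circ> (\<lambda>y. \<lfloor>2 ^ N * y\<rfloor>)"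
    by auto
  have "(\<lambda>y. \<lfloor>2 ^ N * y\<rfloor>) \<in> measurable (dyadic_filtration N) (count_space UNIV)"
  proof (subst measurable_count_space_eq_countable, simp, intro conjI ballI)
    fix m :: int
    show "(\<lambda>y. \<lfloor>2 ^ N * y\<rfloor>) -` {m} \<inter> space (dyadic_filtration N) \<in> sets (dyadic_filtration N)"
    proof (cases "\<exists>x\<in>{0..<1::real}. \<lfloor>2 ^ N * x\<rfloor> = m")
      case True
      then obtain x :: real where x: "x \<in> {0..<1}" "\<lfloor>2 ^ N * x\<rfloor> = m" by blast
      then have "(\<lambda>y. \<lfloor>2 ^ N * y\<rfloor>) -` {m} \<inter> space (dyadic_filtration N) = cell N x"
        using cell_subset_unit[OF x(1), of N] by (auto simp: cell_def)
      then show ?thesis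
        using cell_in_dyadic_intervals[OF x(1)] by (simp add: sets_dyadic_filtration)
    next
      case False
      then have "(\<lambda>y. \<lfloor>2 ^ N * y\<rfloor>) -` {m} \<inter> space (dyadic_filtration N) = {}" by auto
      then show ?thesis by simp
    qed
  qed auto
  then show ?thesis
    by (subst h) (rule measurable_comp, auto)
qed

lemma martingale_walsh_inner:
  assumes "martingale unit_lebesgue dyadic_filtration f" "l < 2 ^ N" "N \<le> m"
  shows "walsh_inner (f m) l = walsh_inner (f N) l"
proof -
  have f: "integrable unit_lebesgue (f m)" "AE x in unit_lebesgue. real_cond_exp unit_lebesgue (dyadic_filtration N) (f m) x = f N x"
    "f N \<in> borel_measurable (dyadic_filtration N)"
    using assms(1,3) by (auto simp: martingale_def)
  have sub: "subalgebra unit_lebesgue (dyadic_filtration N)" by (rule subalgebra_dyadic_filtration)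
  interpret finite_measure unit_lebesgue
    by (rule finite_measureI) (simp add: emeasure_restrict_space)
  interpret sigma_finite_subalgebra unit_lebesgue "dyadic_filtration N"
    by (rule finite_measure_subalgebra_is_sigma_finite) (simp add: finite_measure_subalgebra_def
        finite_measure_subalgebra_axioms_def sub finite_measure_axioms)
  have w: "walsh l \<in> borel_measurable (dyadic_filtration N)"
    by (rule const_cell_dyadic_measurable) (rule walsh_cong_cell[OF _ assms(2)])
  have [measurable]: "f N \<in> borel_measurable unit_lebesgue" by (rule measurable_from_subalg[OF sub f(3)])
  have [measurable]: "walsh l \<in> borel_measurable unit_lebesgue" by (rule measurable_from_subalg[OF sub w])
  have "walsh_inner (f m) l = (\<integral>x. walsh l x * real_cond_exp unit_lebesgue (dyadic_filtration N) (f m) x \<partial>unit_lebesgue)"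
    unfolding walsh_inner_def
    by (rule real_cond_exp_intg(2)[symmetric]) (use f w integrable_walsh_mult[OF f(1)] in auto)
  also have "\<dots> = walsh_inner (f N) l"
    unfolding walsh_inner_def by (rule integral_cong_AE) (use f(2) in auto)
  finally show ?thesis .
qed

lemma walsh_coeff_eq:
  assumes "martingale unit_lebesgue dyadic_filtration f" "l < 2 ^ N"
  shows "walsh_coeff f l = walsh_inner (f N) l"
  unfolding walsh_coeff_def
proof (rule limI, rule tendsto_eventually)
  show "\<forall>\<^sub>F k in sequentially. (\<integral>x. f k x * walsh l x \<partial>unit_lebesgue) = walsh_inner (f N) l"
    using eventually_ge_at_top[of N]
  proof eventually_elim
    case (elim k)
    from martingale_walsh_inner[OF assms elim] show ?case
      by (simp add: walsh_inner_def mult.commute)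
  qed
qed

lemma fejer_mean_eq:
  assumes "martingale unit_lebesgue dyadic_filtration f" "n < 2 ^ N"
  shows "fejer_mean n f x = fejer_sum n (f N) x / real n"
proof -
  have "(\<Sum>k=1..n. \<Sum>l<k. g l) = (\<Sum>l<n. (real n - real l) * g l)" for g :: "nat \<Rightarrow> real"
  proof (induction n)
    case (Suc n)
    have "(\<Sum>l<n. (real (Suc n) - real l) * g l) = (\<Sum>l<n. (real n - real l) * g l) + (\<Sum>l<n. g l)"
      by (simp add: sum.distrib[symmetric] algebra_simps)
    then show ?case using Suc by simp
  qed simp
  from this[of "\<lambda>l. walsh_coeff f l * walsh l x"]
  have "fejer_mean n f x = (\<Sum>l<n. (real n - real l) * (walsh_coeff f l * walsh l x)) / real n"
    by (simp add: fejer_mean_def walsh_partial_sum_def)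
  also have "(\<Sum>l<n. (real n - real l) * (walsh_coeff f l * walsh l x)) = fejer_sum n (f N) x"
    unfolding fejer_sum_def using assms by (intro sum.cong) (auto simp: walsh_coeff_eq)
  finally show ?thesis .
qed

lemma integrable_powr_le:
  fixes h :: "real \<Rightarrow> real"
  assumes "integrable unit_lebesgue h" "\<And>t. 0 \<le> h t" "0 < r" "r \<le> 1"
  shows "integrable unit_lebesgue (\<lambda>t. h t powr r)"
proof (rule Bochner_Integration.integrable_bound)
  show "integrable unit_lebesgue (\<lambda>t. 1 + h t)"
    using assms(1) integrable_const_unit by (intro Bochner_Integration.integrable_add) auto
  show "(\<lambda>t. h t powr r) \<in> borel_measurable unit_lebesgue" using assms(1) by measurable
  have "h t powr r \<le> 1 + h t" for t
  proof (cases "h t \<le> 1")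
    case True
    then have "h t powr r \<le> 1 powr r" using assms by (intro powr_mono2) auto
    then show ?thesis using assms(2)[of t] by simp
  next
    case False
    then have "h t powr r \<le> h t powr 1" using assms by (intro powr_mono) auto
    then show ?thesis using False by simp
  qed
  then show "AE t in unit_lebesgue. norm (h t powr r) \<le> norm (1 + h t)"
    using assms(2) by (auto simp: add_nonneg_nonneg)
qed

text \<open>A reverse Jensen inequality for step functions of level \<open>N\<close>: this is where the exponent \<open>r < 1\<close>
  costs a power of \<open>2\<^sup>N\<^sup>-\<^sup>i\<close>, the ratio of the two scales.\<close>

lemma cell_mean_le_powr_mean:
  fixes h :: "real \<Rightarrow> real"
  assumes int: "integrable unit_lebesgue h" and nonneg: "\<And>t. 0 \<le> h t"
    and step: "\<And>s t. s \<in> {0..<1} \<Longrightarrow> t \<in> cell N s \<Longrightarrow> h t = h s"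
    and r: "0 < r" "r \<le> 1" and y: "y \<in> {0..<1}" and iN: "i \<le> N"
  shows "cell_mean i h y \<le> (2 powr (1 / r - 1)) ^ (N - i) * cell_mean i (\<lambda>t. h t powr r) y powr (1 / r)"
proof -
  define e where "e = cell_mean i (\<lambda>t. h t powr r) y"
  define L where "L = 2 ^ (N - i) * e"
  have e0: "0 \<le> e" unfolding e_def by (rule cell_mean_nonneg) simp
  then have L0: "0 \<le> L" by (simp add: L_def)
  note intr = integrable_powr_le[OF int nonneg r]
  \<comment> \<open>On \<open>cell i y\<close>, the step function \<open>h\<close> is at most \<open>L\<^bsup>1/r\<^esup>\<close>, since each of its steps contributes to \<open>e\<close>.\<close>
  have bound: "h t \<le> L powr (1 / r - 1) * (h t powr r)" if t: "t \<in> cell i y" for t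
  proof -
    have tu: "t \<in> {0..<1}" using t cell_subset_unit[OF y] by blast
    have "h t powr r = cell_mean N (\<lambda>_. h t powr r) t" by (simp add: cell_mean_const[OF tu])
    also have "\<dots> = cell_mean N (\<lambda>s. h s powr r) t"
    proof -
      have "(\<integral>s. indicator (cell N t) s * (h t powr r) \<partial>unit_lebesgue) = (\<integral>s. indicator (cell N t) s * (h s powr r) \<partial>unit_lebesgue)"
        by (intro Bochner_Integration.integral_cong refl) (metis indicator_simps(2) mult_zero_left step[OF tu])
      then show ?thesis by (simp add: cell_mean_def)
    qed
    also have "\<dots> \<le> 2 ^ (N - i) * cell_mean i (\<lambda>s. h s powr r) t"
      by (rule cell_mean_le_coarser[OF intr _ iN]) simp
    also have "\<dots> = L"
      using cell_mean_cong_cell[OF t] by (simp add: L_def e_def)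
    finally have "(h t powr r) powr (1 / r) \<le> L powr (1 / r)"
      using r by (intro powr_mono2) auto
    then have "h t \<le> L powr (1 / r)" using nonneg r by (simp add: powr_powr)
    then have "h t powr (1 - r) \<le> (L powr (1 / r)) powr (1 - r)"
      using nonneg r by (intro powr_mono2) auto
    also have "\<dots> = L powr (1 / r - 1)" using r by (simp add: powr_powr field_simps)
    finally have "h t powr r * h t powr (1 - r) \<le> h t powr r * L powr (1 / r - 1)"
      by (intro mult_left_mono) auto
    then show ?thesis using nonneg by (simp add: powr_add[symmetric] mult.commute)
  qed
  have "cell_mean i h y \<le> cell_mean i (\<lambda>t. L powr (1 / r - 1) * (h t powr r)) y"
    using bound by (intro cell_mean_mono int integrable_mult_right intr) auto
  also have "\<dots> = L powr (1 / r - 1) * e" by (simp add: cell_mean_cmult e_def)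
  also have "\<dots> = (2 ^ (N - i)) powr (1 / r - 1) * (e * e powr (1 / r - 1))"
    unfolding L_def using e0 by (subst powr_mult) auto
  also have "e * e powr (1 / r - 1) = e powr (1 / r)"
    using e0 by (simp add: powr_mult_base)
  also have "((2::real) ^ (N - i)) powr (1 / r - 1) = (2 powr (1 / r - 1)) ^ (N - i)"
    by (simp add: powr_realpow[symmetric] powr_powr mult.commute)
  finally show ?thesis by (simp add: e_def)
qed

lemma geometric_sum_le:
  fixes q :: real
  assumes "0 \<le> q" "q < 1"
  shows "(\<Sum>k<m. q ^ k) \<le> 1 / (1 - q)"
  using assms by (simp add: sum_gp_strict divide_right_mono)

text \<open>The pointwise majorant of the Fejer means. The martingale enters only through a majorant \<open>G\<close> of its maximal
  function. For \<open>2\<^sup>N\<^sup>-\<^sup>1 \<le> n < 2\<^sup>N\<close> the reverse Jensen inequality loses \<open>2\<^bsup>(N - i)(1/r - 1)\<^esup>\<close> at level \<open>i\<close>, whereas the kernel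
  supplies the factor \<open>2\<^bsup>i - N\<^esup>\<close>; the product is summable over \<open>i\<close> because \<open>r > 1/2\<close>. The sum over
  \<open>k = i - j\<close> tolerates a growth \<open>b\<^sup>k\<close> with \<open>b < 2\<close>.\<close>

lemma abs_fejer_mean_le:
  assumes f: "martingale unit_lebesgue dyadic_filtration f"
    and G: "\<And>N. AE t in unit_lebesgue. \<bar>f N t\<bar> \<le> G t"
    and Gr: "integrable unit_lebesgue (\<lambda>t. G t powr r)"
    and r: "1 / 2 < r" "r \<le> 1" and b: "0 \<le> b" "b < 2" and x: "x \<in> {0..<1}"
    and B: "\<And>i k. k \<le> i \<Longrightarrow> cell_mean i (\<lambda>t. G t powr r) (flip (i - k) x) powr (1 / r) \<le> b ^ k * B"
    and n: "1 \<le> n"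
  shows "\<bar>fejer_mean n f x\<bar> \<le> 4 / ((1 - b / 2) * (1 - 2 powr (1 / r - 1) / 2)) * B"
proof -
  define a :: real where "a = 2 powr (1 / r - 1)"
  have "1 / r < 2" using r by (simp add: field_simps)
  then have "a < 2 powr 1" unfolding a_def by (intro powr_less_mono) auto
  then have a: "0 \<le> a" "a < 2" by (auto simp: a_def)
  have "0 \<le> cell_mean 0 (\<lambda>t. G t powr r) (flip 0 x) powr (1 / r)" by simp
  also have "\<dots> \<le> B" using B[of 0 0] by simp
  finally have B0: "0 \<le> B" .
  \<comment> \<open>\<open>N\<close> is the number of binary digits of \<open>n\<close>.\<close>
  obtain M where M: "2 ^ M \<le> n" "n < 2 ^ Suc M"
    using ex_power_ivl1[of 2 n] n by auto
  define N where "N = Suc M"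
  have nN: "n < 2 ^ N" using M by (simp add: N_def)
  have "real (2 ^ M) \<le> real n" using M(1) by (subst of_nat_le_iff)
  then have n2: "2 ^ N \<le> 2 * real n" by (simp add: N_def)
  have fint: "integrable unit_lebesgue (f N)" and fmeas: "f N \<in> borel_measurable (dyadic_filtration N)"
    using f by (auto simp: martingale_def)
  have mean: "cell_mean i (\<lambda>t. \<bar>f N t\<bar>) (flip j x) \<le> a ^ (N - i) * (b ^ (i - j) * B)" if "j \<le> i" "i \<le> N" for i j
  proof -
    have "cell_mean i (\<lambda>t. \<bar>f N t\<bar>) (flip j x)
        \<le> a ^ (N - i) * cell_mean i (\<lambda>t. \<bar>f N t\<bar> powr r) (flip j x) powr (1 / r)"
      unfolding a_def
    proof (rule cell_mean_le_powr_mean)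
      show "\<bar>f N t\<bar> = \<bar>f N s\<bar>" if "s \<in> {0..<1}" "t \<in> cell N s" for s t
        using dyadic_measurable_const_cell[OF fmeas that] by simp
    qed (use fint r that flip_in_unit[OF x] in auto)
    also have "\<dots> \<le> a ^ (N - i) * (b ^ (i - j) * B)"
    proof (intro mult_left_mono)
      have "cell_mean i (\<lambda>t. \<bar>f N t\<bar> powr r) (flip j x) \<le> cell_mean i (\<lambda>t. G t powr r) (flip j x)"
      proof (rule cell_mean_mono[OF _ Gr])
        show "integrable unit_lebesgue (\<lambda>t. \<bar>f N t\<bar> powr r)"
          using fint r by (intro integrable_powr_le) auto
        show "AE t in unit_lebesgue. t \<in> cell i (flip j x) \<longrightarrow> \<bar>f N t\<bar> powr r \<le> G t powr r"
          using G[of N] by eventually_elim (use r in \<open>auto intro!: powr_mono2\<close>)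
      qed
      then have "cell_mean i (\<lambda>t. \<bar>f N t\<bar> powr r) (flip j x) powr (1 / r) \<le> cell_mean i (\<lambda>t. G t powr r) (flip j x) powr (1 / r)"
        using r by (intro powr_mono2 cell_mean_nonneg) auto
      also have "\<dots> \<le> b ^ (i - j) * B"
        using B[of "i - j" i] that by simp
      finally show "cell_mean i (\<lambda>t. \<bar>f N t\<bar> powr r) (flip j x) powr (1 / r) \<le> b ^ (i - j) * B" .
      show "0 \<le> a ^ (N - i)" using a by simp
    qed
    finally show ?thesis .
  qed
  have inner: "(\<Sum>j\<le>i. 2 ^ Suc j * b ^ (i - j)) \<le> 2 ^ Suc i / (1 - b / 2)" for i
  proof -
    have "(\<Sum>j\<le>i. 2 ^ Suc j * b ^ (i - j)) = (\<Sum>j<Suc i. 2 ^ Suc i * (b / 2) ^ (Suc i - Suc j))"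
      unfolding lessThan_Suc_atMost
    proof (intro sum.cong refl)
      fix j assume "j \<in> {..i}"
      then have "(2::real) ^ i = 2 ^ j * 2 ^ (i - j)" by (subst power_add[symmetric]) simp
      then show "2 ^ Suc j * b ^ (i - j) = 2 ^ Suc i * (b / 2) ^ (Suc i - Suc j)"
        by (simp add: power_divide)
    qed
    also have "\<dots> = 2 ^ Suc i * (\<Sum>k<Suc i. (b / 2) ^ k)"
      unfolding sum_distrib_left[symmetric] by (subst sum.nat_diff_reindex) rule
    also have "\<dots> \<le> 2 ^ Suc i * (1 / (1 - b / 2))"
      using b by (intro mult_left_mono geometric_sum_le) auto
    finally show ?thesis by simp
  qed
  have outer: "(\<Sum>i<N. 2 ^ Suc i * a ^ (N - i)) \<le> 2 * 2 ^ N / (1 - a / 2)"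
  proof -
    have "(\<Sum>i<N. 2 ^ Suc i * a ^ (N - i)) \<le> (\<Sum>i<N. 2 * 2 ^ N * (a / 2) ^ (N - Suc i))"
    proof (intro sum_mono)
      fix i assume "i \<in> {..<N}"
      then have *: "N - i = Suc (N - Suc i)" "(2::real) ^ N = 2 ^ i * 2 ^ (N - i)"
        by (auto simp: power_add[symmetric])
      have "2 ^ Suc i * a ^ (N - i) = a * (2 ^ N * (a / 2) ^ (N - Suc i))"
        unfolding *(2) unfolding *(1) by (simp add: power_divide)
      also have "\<dots> \<le> 2 * (2 ^ N * (a / 2) ^ (N - Suc i))"
        using a by (intro mult_right_mono) auto
      finally show "2 ^ Suc i * a ^ (N - i) \<le> 2 * 2 ^ N * (a / 2) ^ (N - Suc i)" by simp
    qed
    also have "\<dots> = 2 * 2 ^ N * (\<Sum>k<N. (a / 2) ^ k)"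
      unfolding sum_distrib_left[symmetric] by (subst sum.nat_diff_reindex) rule
    also have "\<dots> \<le> 2 * 2 ^ N * (1 / (1 - a / 2))"
      using a by (intro mult_left_mono geometric_sum_le) auto
    finally show ?thesis by simp
  qed
  have "\<bar>fejer_sum n (f N) x\<bar> \<le> (\<Sum>i<N. \<Sum>j\<le>i. 2 ^ Suc j * cell_mean i (\<lambda>t. \<bar>f N t\<bar>) (flip j x))"
    by (rule abs_fejer_sum_le[OF fint x nN])
  also have "\<dots> \<le> (\<Sum>i<N. \<Sum>j\<le>i. 2 ^ Suc j * (a ^ (N - i) * (b ^ (i - j) * B)))"
    by (intro sum_mono mult_left_mono mean) auto
  also have "\<dots> = (\<Sum>i<N. B * a ^ (N - i) * (\<Sum>j\<le>i. 2 ^ Suc j * b ^ (i - j)))"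
    by (simp add: sum_distrib_left mult_ac)
  also have "\<dots> \<le> (\<Sum>i<N. B * a ^ (N - i) * (2 ^ Suc i / (1 - b / 2)))"
    using B0 a by (intro sum_mono mult_left_mono inner) auto
  also have "\<dots> = B / (1 - b / 2) * (\<Sum>i<N. 2 ^ Suc i * a ^ (N - i))"
    by (simp add: sum_distrib_left mult_ac)
  also have "\<dots> \<le> B / (1 - b / 2) * (2 * 2 ^ N / (1 - a / 2))"
    using B0 b by (intro mult_left_mono outer) auto
  also have "\<dots> = 2 * B / ((1 - b / 2) * (1 - a / 2)) * 2 ^ N"
    by simp
  also have "\<dots> \<le> 2 * B / ((1 - b / 2) * (1 - a / 2)) * (2 * real n)"
    using B0 a b n2 by (intro mult_left_mono) (auto intro!: divide_nonneg_nonneg)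
  finally have "\<bar>fejer_sum n (f N) x\<bar> / real n \<le> 4 / ((1 - b / 2) * (1 - a / 2)) * B"
    using n by (simp add: divide_le_eq)
  then show ?thesis
    unfolding fejer_mean_eq[OF f nN] a_def by simp
qed

section \<open>The shifted dyadic maximal inequality\<close>

lemma cell_mean_borel [measurable]: "cell_mean i \<phi> \<in> borel_measurable borel"
proof -
  have "cell_mean i \<phi> y = cell_mean i \<phi> (of_int \<lfloor>2 ^ i * y\<rfloor> / 2 ^ i)" for y
    by (rule cell_mean_cong_cell) (simp add: cell_def)
  then have h: "cell_mean i \<phi> = (\<lambda>m. cell_mean i \<phi> (of_int m / 2 ^ i)) \<circ> (\<lambda>y. \<lfloor>2 ^ i * y\<rfloor>)"
    by auto
  have *: "(\<lambda>y::real. \<lfloor>2 ^ i * y\<rfloor>) \<in> measurable borel (count_space UNIV)"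
    by measurable
  show ?thesis
    by (subst h) (rule measurable_comp[OF *], simp)
qed

lemma borel_unit_sets: "A \<in> sets borel \<Longrightarrow> A \<subseteq> {0..<1} \<Longrightarrow> A \<in> sets unit_lebesgue"
  by (auto simp: sets_restrict_space_iff)

lemma emeasure_flip_le:
  assumes [measurable]: "S \<in> sets borel" and S: "S \<subseteq> {0..<1}"
  shows "emeasure unit_lebesgue {x \<in> {0..<1}. flip j x \<in> S} \<le> emeasure unit_lebesgue S"
proof -
  define c :: real where "c = 1 / 2 ^ (j + 1)"
  define P where "P = {x \<in> S. rademacher j x = 1}"
  define N where "N = {x \<in> S. rademacher j x = - 1}"
  have [measurable]: "P \<in> sets borel" "N \<in> sets borel" unfolding P_def N_def by measurable
  have PN: "P \<union> N = S" "P \<inter> N = {}"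
    using rademacher_cases[of j] by (auto simp: P_def N_def)
  have tr: "(\<lambda>x. 1 *\<^sub>R x + d) ` A \<in> sets lebesgue \<and> emeasure lebesgue ((\<lambda>x. 1 *\<^sub>R x + d) ` A) = emeasure lebesgue A"
    if "A \<in> sets borel" for A :: "real set" and d
  proof
    have "A \<in> sets lebesgue" using that by simp
    from lebesgue_sets_translation[OF this, of d]
    show "(\<lambda>x. 1 *\<^sub>R x + d) ` A \<in> sets lebesgue" by (simp add: add.commute)
    show "emeasure lebesgue ((\<lambda>x. 1 *\<^sub>R x + d) ` A) = emeasure lebesgue A"
      using emeasure_lebesgue_affine[of 1 d A] by simp
  qed
  have "{x \<in> {0..<1}. flip j x \<in> S} \<subseteq> (\<lambda>x. 1 *\<^sub>R x + c) ` P \<union> (\<lambda>x. 1 *\<^sub>R x + - c) ` N"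
  proof
    fix x assume x: "x \<in> {x \<in> {0..<1}. flip j x \<in> S}"
    have "x = flip j x + rademacher j (flip j x) * c"
      using flip_flip[of j x] by (simp add: flip_def[of j "flip j x"] c_def)
    then show "x \<in> (\<lambda>x. 1 *\<^sub>R x + c) ` P \<union> (\<lambda>x. 1 *\<^sub>R x + - c) ` N"
      using x rademacher_cases[of j "flip j x"] by (auto simp: P_def N_def image_iff)
  qed
  then have "emeasure lebesgue {x \<in> {0..<1}. flip j x \<in> S} \<le> emeasure lebesgue ((\<lambda>x. 1 *\<^sub>R x + c) ` P \<union> (\<lambda>x. 1 *\<^sub>R x + - c) ` N)"
    using tr[of P c] tr[of N "- c"] by (intro emeasure_mono) auto
  also have "\<dots> \<le> emeasure lebesgue ((\<lambda>x. 1 *\<^sub>R x + c) ` P) + emeasure lebesgue ((\<lambda>x. 1 *\<^sub>R x + - c) ` N)"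
    using tr[of P c] tr[of N "- c"] by (intro emeasure_subadditive) auto
  also have "\<dots> = emeasure lebesgue P + emeasure lebesgue N"
    using tr[of P c] tr[of N "- c"] by simp
  also have "\<dots> = emeasure lebesgue S"
    using PN by (subst plus_emeasure) auto
  finally show ?thesis
    using S by (subst (1 2) emeasure_restrict_space) auto
qed

text \<open>The union of those maximal dyadic intervals on which the mean of \<open>u\<close> exceeds \<open>\<alpha>\<close> that have length \<open>2\<^sup>-\<^sup>i\<close>.\<close>

definition stopping_set :: "(real \<Rightarrow> real) \<Rightarrow> real \<Rightarrow> nat \<Rightarrow> real set"
  where "stopping_set u \<alpha> i = {x \<in> {0..<1}. \<alpha> < cell_mean i u x \<and> (\<forall>j<i. cell_mean j u x \<le> \<alpha>)}"

text \<open>A level set of the shifted maximal function: the interval whose mean is taken is a dyadic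
  translate of \<open>cell i x\<close> inside the common ancestor \<open>cell (i - k) x\<close>. For \<open>k = 0\<close> the
  translate is \<open>cell i x\<close>.\<close>

definition shifted_level_set :: "(real \<Rightarrow> real) \<Rightarrow> real \<Rightarrow> nat \<Rightarrow> real set"
  where "shifted_level_set u \<alpha> k = {x \<in> {0..<1}. \<exists>i\<ge>k. \<alpha> < cell_mean i u (flip (i - k) x)}"

lemma stopping_set_borel [measurable]: "stopping_set u \<alpha> i \<in> sets borel"
  unfolding stopping_set_def by measurable

lemma shifted_level_set_borel [measurable]: "shifted_level_set u \<alpha> k \<in> sets borel"
  unfolding shifted_level_set_def by measurable

lemma stopping_set_subset: "stopping_set u \<alpha> i \<subseteq> {0..<1}"
  by (auto simp: stopping_set_def)

lemma shifted_level_set_subset: "shifted_level_set u \<alpha> k \<subseteq> {0..<1}"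
  by (auto simp: shifted_level_set_def)

lemma disjoint_stopping_sets: "disjoint_family (stopping_set u \<alpha>)"
proof (unfold disjoint_family_on_def, intro ballI impI)
  fix m n :: nat assume "m \<noteq> n"
  then show "stopping_set u \<alpha> m \<inter> stopping_set u \<alpha> n = {}"
    by (cases m n rule: linorder_cases) (force simp: stopping_set_def)+
qed

lemma finite_dyadic_intervals: "finite (dyadic_intervals i)"
proof -
  have "dyadic_intervals i = (\<lambda>k. {real k / 2 ^ i ..< (real k + 1) / 2 ^ i}) ` {..<2 ^ i}"
    by (auto simp: dyadic_intervals_def)
  then show ?thesis by simp
qed

text \<open>Where the mean of \<open>u\<close> exceeds \<open>2 \<alpha>\<close>, the part of \<open>u\<close> above \<open>\<alpha>\<close> still has a mean greater than \<open>\<alpha>\<close>.\<close>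

lemma emeasure_stopping_set_le:
  fixes u :: "real \<Rightarrow> real"
  assumes int: "integrable unit_lebesgue u" and nonneg: "\<And>t. 0 \<le> u t" and \<alpha>: "0 < \<alpha>"
  shows "ennreal \<alpha> * emeasure unit_lebesgue (stopping_set u (2 * \<alpha>) i)
       \<le> emeasure (density unit_lebesgue (\<lambda>t. ennreal (if \<alpha> < u t then u t else 0))) (stopping_set u (2 * \<alpha>) i)"
proof -
  define w where "w t = (if \<alpha> < u t then u t else 0)" for t
  have [measurable]: "u \<in> borel_measurable unit_lebesgue" using int by auto
  have w0: "0 \<le> w t" for t using nonneg by (simp add: w_def)
  have [measurable]: "w \<in> borel_measurable unit_lebesgue" unfolding w_def by measurable
  have wint: "integrable unit_lebesgue w"
    by (rule Bochner_Integration.integrable_bound[OF int]) (auto simp: w_def)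
  define S where "S = stopping_set u (2 * \<alpha>) i"
  let ?N = "density unit_lebesgue (\<lambda>t. ennreal (w t))"
  define D where "D = {C \<in> dyadic_intervals i. C \<subseteq> S}"
  have finD: "finite D" unfolding D_def using finite_dyadic_intervals by auto
  have cellS: "cell i x \<subseteq> S" if "x \<in> S" for x
  proof
    fix y assume y: "y \<in> cell i x"
    have x: "x \<in> {0..<1}" using that stopping_set_subset S_def by blast
    have "y \<in> cell j x" if "j \<le> i" for j using cell_antimono[OF that, of x] y by blast
    then have "cell_mean j u y = cell_mean j u x" if "j \<le> i" for j
      using that cell_mean_cong_cell by blast
    then show "y \<in> S"
      using \<open>x \<in> S\<close> y cell_subset_unit[OF x, of i] unfolding S_def stopping_set_def by auto
  qed
  have S_eq: "S = (\<Union>C\<in>D. C)"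
  proof
    show "S \<subseteq> (\<Union>C\<in>D. C)"
    proof
      fix x assume "x \<in> S"
      then have "cell i x \<in> D"
        using cellS cell_in_dyadic_intervals stopping_set_subset unfolding D_def S_def by blast
      then show "x \<in> (\<Union>C\<in>D. C)" using cell_refl by blast
    qed
  qed (auto simp: D_def)
  have disj: "disjoint_family_on (\<lambda>C. C) D"
    unfolding disjoint_family_on_def D_def using dyadic_interval_eq_cell(1) by blast
  have sub: "(\<lambda>C. C) ` D \<subseteq> sets unit_lebesgue"
  proof clarify
    fix C assume C: "C \<in> D"
    show "C \<in> sets unit_lebesgue"
    proof (cases "C = {}")
      case False
      then obtain x where "x \<in> C" by blast
      then show ?thesis using C dyadic_interval_eq_cell[of C i x] cell_unit_sets by (auto simp: D_def)
    qed simp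
  qed
  have each: "ennreal \<alpha> * emeasure unit_lebesgue C \<le> emeasure ?N C" if "C \<in> D" for C
  proof (cases "C = {}")
    case False
    then obtain x where "x \<in> C" by blast
    with that have x: "C = cell i x" "x \<in> {0..<1}" "x \<in> S"
      using dyadic_interval_eq_cell[of C i x] by (auto simp: D_def)
    have "2 * \<alpha> < cell_mean i u x" using x(3) by (simp add: S_def stopping_set_def)
    also have "\<dots> \<le> cell_mean i (\<lambda>t. \<alpha> + w t) x"
    proof (rule cell_mean_mono[OF int])
      show "integrable unit_lebesgue (\<lambda>t. \<alpha> + w t)"
        by (intro Bochner_Integration.integrable_add integrable_const_unit wint)
    qed (use \<alpha> in \<open>auto simp: w_def\<close>)
    also have "\<dots> = \<alpha> + cell_mean i w x"
      using cell_mean_add[OF integrable_const_unit wint] cell_mean_const[OF x(2)] by simp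
    finally have "\<alpha> \<le> cell_mean i w x" by simp
    then have "\<alpha> * (1 / 2 ^ i) \<le> (\<integral>t. indicator (cell i x) t * w t \<partial>unit_lebesgue)"
      by (simp add: cell_mean_def field_simps)
    then have "ennreal (\<alpha> * (1 / 2 ^ i)) \<le> ennreal (\<integral>t. indicator (cell i x) t * w t \<partial>unit_lebesgue)"
      by (rule ennreal_leI)
    also have "\<dots> = (\<integral>\<^sup>+t. ennreal (indicator (cell i x) t * w t) \<partial>unit_lebesgue)"
      using w0 by (intro nn_integral_eq_integral[symmetric] integrable_indicator_cell wint) auto
    also have "\<dots> = (\<integral>\<^sup>+t. ennreal (w t) * indicator (cell i x) t \<partial>unit_lebesgue)"
      by (intro nn_integral_cong) (auto simp: indicator_def)
    also have "\<dots> = emeasure ?N (cell i x)"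
      using cell_unit_sets[OF x(2)] by (subst emeasure_density) auto
    finally have "ennreal \<alpha> * ennreal (1 / 2 ^ i) \<le> emeasure ?N (cell i x)"
      using \<alpha> by (subst ennreal_mult[symmetric]) auto
    then show ?thesis
      unfolding x(1) emeasure_cell[OF x(2)] .
  qed simp
  have "ennreal \<alpha> * emeasure unit_lebesgue S = (\<Sum>C\<in>D. ennreal \<alpha> * emeasure unit_lebesgue C)"
    unfolding S_eq sum_emeasure[OF sub disj finD, symmetric] by (rule sum_distrib_left)
  also have "\<dots> \<le> (\<Sum>C\<in>D. emeasure ?N C)"
    by (intro sum_mono each)
  also have "\<dots> = emeasure ?N S"
    unfolding S_eq using sub by (intro sum_emeasure disj finD) simp
  finally show ?thesis unfolding S_def w_def .
qed

lemma sum_emeasure_stopping_set_le: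
  fixes u :: "real \<Rightarrow> real"
  assumes int: "integrable unit_lebesgue u" and nonneg: "\<And>t. 0 \<le> u t" and \<alpha>: "0 < \<alpha>"
  shows "ennreal \<alpha> * (\<Sum>i. emeasure unit_lebesgue (stopping_set u (2 * \<alpha>) i))
       \<le> (\<integral>\<^sup>+t. ennreal (if \<alpha> < u t then u t else 0) \<partial>unit_lebesgue)"
proof -
  let ?w = "\<lambda>t. ennreal (if \<alpha> < u t then u t else 0)"
  let ?N = "density unit_lebesgue ?w"
  have [measurable]: "u \<in> borel_measurable unit_lebesgue" using int by auto
  have s: "range (stopping_set u (2 * \<alpha>)) \<subseteq> sets ?N"
    using borel_unit_sets[OF stopping_set_borel stopping_set_subset] by auto
  have "ennreal \<alpha> * (\<Sum>i. emeasure unit_lebesgue (stopping_set u (2 * \<alpha>) i))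
      = (\<Sum>i. ennreal \<alpha> * emeasure unit_lebesgue (stopping_set u (2 * \<alpha>) i))"
    by simp
  also have "\<dots> \<le> (\<Sum>i. emeasure ?N (stopping_set u (2 * \<alpha>) i))"
    by (intro suminf_le emeasure_stopping_set_le assms) auto
  also have "\<dots> = emeasure ?N (\<Union>i. stopping_set u (2 * \<alpha>) i)"
    by (rule suminf_emeasure[OF s disjoint_stopping_sets])
  also have "\<dots> \<le> emeasure ?N (space ?N)"
    by (rule emeasure_space)
  also have "\<dots> = (\<integral>\<^sup>+t. ?w t \<partial>unit_lebesgue)"
    by (simp add: emeasure_density del: space_restrict_space)
       (intro nn_integral_cong, auto)
  finally show ?thesis .
qed

text \<open>Shifting the intervals costs only a factor that is linear in \<open>k\<close>. If the mean over \<open>cell i (flip (i - k) x)\<close>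
  exceeds \<open>\<alpha>\<close>, the maximal interval around this cell either contains \<open>x\<close>, or its level is
  one of \<open>i - k + 1, \<dots>, i\<close>. In the second case the level \<open>l\<close> and the difference \<open>l - (i - k)\<close> determine the digit that
  is flipped, and flipping a digit preserves the measure of the stopping set of level \<open>l\<close>.\<close>

lemma emeasure_shifted_level_set_le:
  "emeasure unit_lebesgue (shifted_level_set u \<alpha> k)
     \<le> ennreal (real (Suc k)) * (\<Sum>i. emeasure unit_lebesgue (stopping_set u \<alpha> i))"
proof -
  let ?W = "\<Sum>i. emeasure unit_lebesgue (stopping_set u \<alpha> i)"
  define F where "F m i = {x \<in> {0..<1}. flip (i - Suc m) x \<in> stopping_set u \<alpha> i}" for m i
  define A where "A m = (\<Union>i. F m i)" for m
  define A0 where "A0 = (\<Union>i. stopping_set u \<alpha> i)"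
  have Fb: "F m i \<in> sets borel" for m i unfolding F_def by measurable
  have Fs: "F m i \<in> sets unit_lebesgue" for m i
    by (rule borel_unit_sets[OF Fb]) (auto simp: F_def)
  have Ss: "stopping_set u \<alpha> i \<in> sets unit_lebesgue" for i
    by (rule borel_unit_sets[OF stopping_set_borel stopping_set_subset])
  have A0: "emeasure unit_lebesgue A0 \<le> ?W"
    unfolding A0_def using Ss by (intro emeasure_subadditive_countably) auto
  have A: "emeasure unit_lebesgue (A m) \<le> ?W" for m
  proof -
    have "emeasure unit_lebesgue (A m) \<le> (\<Sum>i. emeasure unit_lebesgue (F m i))"
      unfolding A_def using Fs by (intro emeasure_subadditive_countably) auto
    also have "\<dots> \<le> ?W"
      unfolding F_def by (intro suminf_le emeasure_flip_le stopping_set_borel stopping_set_subset) auto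
    finally show ?thesis .
  qed
  have "shifted_level_set u \<alpha> k \<subseteq> A0 \<union> (\<Union>m<k. A m)"
  proof
    fix x assume "x \<in> shifted_level_set u \<alpha> k"
    then obtain i where x: "x \<in> {0..<1}" and i: "k \<le> i" "\<alpha> < cell_mean i u (flip (i - k) x)"
      by (auto simp: shifted_level_set_def)
    define y where "y = flip (i - k) x"
    have y: "y \<in> {0..<1}" unfolding y_def by (rule flip_in_unit[OF x])
    define l where "l = (LEAST l. \<alpha> < cell_mean l u y)"
    have l: "\<alpha> < cell_mean l u y" "l \<le> i" and lmin: "\<And>j. j < l \<Longrightarrow> cell_mean j u y \<le> \<alpha>"
      unfolding l_def using i(2) by (auto simp: y_def intro: LeastI Least_le dest: not_less_Least)
    have yl: "y \<in> stopping_set u \<alpha> l"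
      using y l lmin by (auto simp: stopping_set_def)
    show "x \<in> A0 \<union> (\<Union>m<k. A m)"
    \<comment> \<open>\<open>x\<close> and \<open>y\<close> have the same cells up to level \<open>i - k\<close>.\<close>
    proof (cases "l \<le> i - k")
      case True
      have "cell_mean j u y = cell_mean j u x" if "j \<le> l" for j
        using flip_in_cell[of j "i - k" x] that True by (auto simp: y_def intro: cell_mean_cong_cell)
      then have "x \<in> stopping_set u \<alpha> l"
        using x l lmin by (auto simp: stopping_set_def)
      then show ?thesis by (auto simp: A0_def)
    next
      case False
      define m where "m = l - (i - k) - 1"
      have "m < k" "l - Suc m = i - k" using False l i(1) by (auto simp: m_def)
      then have "x \<in> F m l" using x yl by (simp add: F_def y_def)
      then show ?thesis using \<open>m < k\<close> by (auto simp: A_def)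
    qed
  qed
  moreover have As: "A0 \<in> sets unit_lebesgue" "A m \<in> sets unit_lebesgue" for m
    using Ss Fs by (auto simp: A0_def A_def)
  ultimately have "emeasure unit_lebesgue (shifted_level_set u \<alpha> k) \<le> emeasure unit_lebesgue (A0 \<union> (\<Union>m<k. A m))"
    by (intro emeasure_mono) auto
  also have "\<dots> \<le> emeasure unit_lebesgue A0 + emeasure unit_lebesgue (\<Union>m<k. A m)"
    using As by (intro emeasure_subadditive) auto
  also have "emeasure unit_lebesgue (\<Union>m<k. A m) \<le> (\<Sum>m<k. emeasure unit_lebesgue (A m))"
    using As by (intro emeasure_subadditive_finite) auto
  also have "\<dots> \<le> (\<Sum>m<k. ?W)" by (intro sum_mono A)
  also have "emeasure unit_lebesgue A0 + (\<Sum>m<k. ?W) \<le> ?W + (\<Sum>m<k. ?W)"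
    by (intro add_right_mono A0)
  also have "\<dots> = of_nat (Suc k) * ?W"
    by (simp add: distrib_right)
  also have "\<dots> = ennreal (real (Suc k)) * ?W"
    by (simp only: ennreal_of_nat_eq_real_of_nat)
  finally show ?thesis by (simp add: add_left_mono)
qed

lemma sum_pow_below_le:
  fixes u q :: real
  assumes "1 < q"
  shows "(\<Sum>n<m. (2 powr (q - 1)) ^ n * (if 2 ^ n < 2 * u then 1 else 0))
      \<le> 2 powr (q - 1) / (2 powr (q - 1) - 1) * (2 * u) powr (q - 1)"
proof -
  define \<rho> :: real where "\<rho> = 2 powr (q - 1)"
  have \<rho>: "1 < \<rho>" using assms by (simp add: \<rho>_def)
  have "(\<Sum>n<m. \<rho> ^ n * (if 2 ^ n < 2 * u then 1 else 0)) \<le> \<rho> / (\<rho> - 1) * (2 * u) powr (q - 1)"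
  proof (induction m)
    case 0
    show ?case using \<rho> by simp
  next
    case (Suc m)
    show ?case
    proof (cases "2 ^ m < 2 * u")
      case True
      have "(\<Sum>n<Suc m. \<rho> ^ n * (if 2 ^ n < 2 * u then 1 else 0)) \<le> (\<Sum>n<Suc m. \<rho> ^ n)"
        using \<rho> by (intro sum_mono) auto
      also have "\<dots> = (\<rho> ^ Suc m - 1) / (\<rho> - 1)"
        using \<rho> by (subst geometric_sum) auto
      also have "\<dots> \<le> \<rho> / (\<rho> - 1) * \<rho> ^ m"
        using \<rho> by (simp add: divide_right_mono)
      also have "\<rho> ^ m = (2 ^ m) powr (q - 1)"
        by (simp add: \<rho>_def powr_realpow[symmetric] powr_powr mult.commute)
      also have "\<rho> / (\<rho> - 1) * \<dots> \<le> \<rho> / (\<rho> - 1) * (2 * u) powr (q - 1)"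
        using \<rho> assms True by (intro mult_left_mono powr_mono2) auto
      finally show ?thesis .
    next
      case False
      then show ?thesis using Suc by simp
    qed
  qed
  then show ?thesis by (simp add: \<rho>_def)
qed

text \<open>The strong type inequality for the shifted maximal function, with the distribution function sampled at the
  powers \<open>2\<^sup>n\<close>, \<open>n \<ge> 0\<close>; on the left is, up to a factor, the integral of its \<open>q\<close>-th power over the
  set where it exceeds \<open>1\<close>.\<close>

lemma shifted_maximal_inequality:
  fixes u :: "real \<Rightarrow> real" and q :: real
  assumes int: "integrable unit_lebesgue u" and nonneg: "\<And>t. 0 \<le> u t" and q: "1 < q"
  defines "\<rho> \<equiv> 2 powr (q - 1)"
  shows "(\<Sum>n. ennreal ((2 powr q) ^ Suc n) * emeasure unit_lebesgue (shifted_level_set u (2 ^ n) k))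
       \<le> ennreal (real (Suc k) * (4 * \<rho> ^ 3 / (\<rho> - 1))) * (\<integral>\<^sup>+t. ennreal (u t powr q) \<partial>unit_lebesgue)"
proof -
  have [measurable]: "u \<in> borel_measurable unit_lebesgue" using int by auto
  have \<rho>: "1 < \<rho>" using q by (simp add: \<rho>_def)
  have Q: "2 powr q = 2 * \<rho>" by (simp add: \<rho>_def powr_diff)
  let ?w = "\<lambda>n t. if 2 ^ n < 2 * u t then u t else 0"
  let ?K = "ennreal (real (Suc k))"
  have "ennreal ((2 powr q) ^ Suc n) * emeasure unit_lebesgue (shifted_level_set u (2 ^ n) k)
      \<le> ?K * (\<integral>\<^sup>+t. ennreal (4 * \<rho> * \<rho> ^ n * ?w n t) \<partial>unit_lebesgue)" for n
  proof -
    define W where "W = (\<Sum>i. emeasure unit_lebesgue (stopping_set u (2 ^ n) i))"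
    define \<alpha> :: real where "\<alpha> = 2 ^ n / 2"
    have w: "(if \<alpha> < u t then u t else 0) = ?w n t" for t
      by (auto simp: \<alpha>_def)
    have W: "ennreal \<alpha> * W \<le> (\<integral>\<^sup>+t. ennreal (?w n t) \<partial>unit_lebesgue)"
      using sum_emeasure_stopping_set_le[OF int nonneg, of \<alpha>] unfolding w by (simp add: \<alpha>_def W_def)
    have "(2 powr q) ^ Suc n = 4 * \<rho> * \<rho> ^ n * \<alpha>"
      unfolding Q by (simp add: \<alpha>_def power_mult_distrib)
    then have e: "ennreal ((2 powr q) ^ Suc n) = ennreal (4 * \<rho> * \<rho> ^ n) * ennreal \<alpha>"
      using \<rho> by (simp only:) (intro ennreal_mult, auto simp: \<alpha>_def)
    have "ennreal ((2 powr q) ^ Suc n) * emeasure unit_lebesgue (shifted_level_set u (2 ^ n) k)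
        \<le> ennreal (4 * \<rho> * \<rho> ^ n) * ennreal \<alpha> * (?K * W)"
      unfolding W_def e by (intro mult_left_mono emeasure_shifted_level_set_le) auto
    also have "\<dots> = ?K * (ennreal (4 * \<rho> * \<rho> ^ n) * (ennreal \<alpha> * W))"
      by (simp only: mult_ac)
    also have "\<dots> \<le> ?K * (ennreal (4 * \<rho> * \<rho> ^ n) * (\<integral>\<^sup>+t. ennreal (?w n t) \<partial>unit_lebesgue))"
      by (intro mult_left_mono W) auto
    also have "ennreal (4 * \<rho> * \<rho> ^ n) * (\<integral>\<^sup>+t. ennreal (?w n t) \<partial>unit_lebesgue)
        = (\<integral>\<^sup>+t. ennreal (4 * \<rho> * \<rho> ^ n * ?w n t) \<partial>unit_lebesgue)"
    proof (subst nn_integral_cmult[symmetric])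
      show "(\<integral>\<^sup>+t. ennreal (4 * \<rho> * \<rho> ^ n) * ennreal (?w n t) \<partial>unit_lebesgue)
          = (\<integral>\<^sup>+t. ennreal (4 * \<rho> * \<rho> ^ n * ?w n t) \<partial>unit_lebesgue)"
        using \<rho> by (intro nn_integral_cong ennreal_mult''[symmetric]) (use nonneg in auto)
    qed measurable
    finally show ?thesis .
  qed
  then have "(\<Sum>n. ennreal ((2 powr q) ^ Suc n) * emeasure unit_lebesgue (shifted_level_set u (2 ^ n) k))
      \<le> (\<Sum>n. ?K * (\<integral>\<^sup>+t. ennreal (4 * \<rho> * \<rho> ^ n * ?w n t) \<partial>unit_lebesgue))"
    by (intro suminf_le) auto
  also have "\<dots> = ?K * (\<integral>\<^sup>+t. (\<Sum>n. ennreal (4 * \<rho> * \<rho> ^ n * ?w n t)) \<partial>unit_lebesgue)"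
    by (subst nn_integral_suminf) auto
  also have "\<dots> \<le> ?K * (\<integral>\<^sup>+t. ennreal (4 * \<rho> ^ 3 / (\<rho> - 1)) * ennreal (u t powr q) \<partial>unit_lebesgue)"
  proof (intro mult_left_mono nn_integral_mono)
    fix t
    have "(\<Sum>n<m. ennreal (4 * \<rho> * \<rho> ^ n * ?w n t)) \<le> ennreal (4 * \<rho> ^ 3 / (\<rho> - 1) * (u t powr q))" for m
    proof -
      have "(\<Sum>n<m. 4 * \<rho> * \<rho> ^ n * ?w n t) = 4 * \<rho> * u t * (\<Sum>n<m. \<rho> ^ n * (if 2 ^ n < 2 * u t then 1 else 0))"
        unfolding sum_distrib_left by (intro sum.cong) auto
      also have "\<dots> \<le> 4 * \<rho> * u t * (\<rho> / (\<rho> - 1) * (2 * u t) powr (q - 1))"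
        using \<rho> nonneg unfolding \<rho>_def by (intro mult_left_mono sum_pow_below_le q) auto
      also have "(2 * u t) powr (q - 1) = \<rho> * u t powr (q - 1)"
        using nonneg by (simp add: powr_mult \<rho>_def)
      also have "4 * \<rho> * u t * (\<rho> / (\<rho> - 1) * (\<rho> * u t powr (q - 1))) = 4 * \<rho> ^ 3 / (\<rho> - 1) * (u t * u t powr (q - 1))"
        by (simp add: power3_eq_cube)
      also have "u t * u t powr (q - 1) = u t powr q"
        using nonneg by (simp add: powr_mult_base)
      finally show ?thesis
        using \<rho> nonneg by (subst sum_ennreal) (auto intro!: ennreal_leI)
    qed
    then have "(\<Sum>n. ennreal (4 * \<rho> * \<rho> ^ n * ?w n t)) \<le> ennreal (4 * \<rho> ^ 3 / (\<rho> - 1) * (u t powr q))"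
      by (intro suminf_le_const) auto
    also have "\<dots> = ennreal (4 * \<rho> ^ 3 / (\<rho> - 1)) * ennreal (u t powr q)"
      using \<rho> by (intro ennreal_mult) auto
    finally show "(\<Sum>n. ennreal (4 * \<rho> * \<rho> ^ n * ?w n t)) \<le> ennreal (4 * \<rho> ^ 3 / (\<rho> - 1)) * ennreal (u t powr q)" .
  qed simp
  also have "\<dots> = ?K * (ennreal (4 * \<rho> ^ 3 / (\<rho> - 1)) * (\<integral>\<^sup>+t. ennreal (u t powr q) \<partial>unit_lebesgue))"
    by (subst nn_integral_cmult) auto
  also have "\<dots> = ennreal (real (Suc k) * (4 * \<rho> ^ 3 / (\<rho> - 1))) * (\<integral>\<^sup>+t. ennreal (u t powr q) \<partial>unit_lebesgue)"
    using \<rho> by (subst ennreal_mult) (auto simp: mult_ac)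
  finally show ?thesis .
qed

section \<open>Means and variable exponents\<close>

lemma term_le_suminf_ennreal: "f n \<le> suminf f" for f :: "nat \<Rightarrow> ennreal"
  using sum_le_suminf[of f "{n}"] by simp

lemma one_plus_powr_le:
  fixes v q :: real
  assumes "0 \<le> v" "1 < q"
  shows "ennreal ((1 + v) powr q)
       \<le> ennreal (2 powr q) * (1 + (\<Sum>n. ennreal ((2 powr q) ^ Suc n) * indicator {m. 2 ^ m < v} n))"
    (is "_ \<le> _ * (1 + suminf ?g)")
proof (cases "v \<le> 1")
  case True
  have "(1 + v) powr q \<le> 2 powr q" using assms True by (intro powr_mono2) auto
  then have "ennreal ((1 + v) powr q) \<le> ennreal (2 powr q) * 1" by (simp add: ennreal_leI)
  also have "\<dots> \<le> ennreal (2 powr q) * (1 + suminf ?g)" by (intro mult_left_mono) auto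
  finally show ?thesis .
next
  case False
  obtain m0 :: nat where "v < 2 ^ m0" using real_arch_pow[of 2 v] by auto
  define m where "m = (LEAST m. v \<le> 2 ^ m)"
  have m: "v \<le> 2 ^ m" unfolding m_def 
    using LeastI[of "\<lambda>m. v \<le> 2 ^ m" m0] \<open>v < 2 ^ m0\<close> by simp
  with False have "m \<noteq> 0" by (intro notI) simp
  then obtain n where n: "m = Suc n" by (cases m) auto
  then have "\<not> v \<le> 2 ^ n" using not_less_Least[of n "\<lambda>m. v \<le> 2 ^ m"] by (simp add: m_def)
  then have vn: "2 ^ n < v" by simp
  have "(1 + v) powr q \<le> (2 * 2 ^ Suc n) powr q"
    using assms False m n by (intro powr_mono2) auto
  also have "\<dots> = 2 powr q * (2 powr q) ^ Suc n"
    by (subst powr_mult) (auto simp: powr_realpow[symmetric] powr_powr powr_mult mult.commute simp del: power_Suc)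
  finally have "ennreal ((1 + v) powr q) \<le> ennreal (2 powr q * (2 powr q) ^ Suc n)"
    by (rule ennreal_leI)
  also have "\<dots> = ennreal (2 powr q) * ?g n"
    using vn by (simp add: ennreal_mult del: power_Suc)
  also have "\<dots> \<le> ennreal (2 powr q) * (1 + suminf ?g)"
  proof (intro mult_left_mono)
    have "?g n \<le> suminf ?g" by (rule term_le_suminf_ennreal)
    then show "?g n \<le> 1 + suminf ?g" by (rule order_trans) simp
  qed simp
  finally show ?thesis .
qed

text \<open>A majorant of all \<open>\<kappa>\<^sup>k (1 + v)\<^sup>q\<close>, where \<open>v\<close> is a mean over a shifted interval. Summing over the
  dyadic levels \<open>2\<^sup>n\<close> in place of taking suprema makes its integral a series of measures of level sets.\<close>

definition level_majorant :: "(real \<Rightarrow> real) \<Rightarrow> real \<Rightarrow> real \<Rightarrow> real \<Rightarrow> ennreal"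
  where "level_majorant u q \<kappa> x =
    (\<Sum>k. ennreal (\<kappa> ^ k * 2 powr q) *
      (1 + (\<Sum>n. ennreal ((2 powr q) ^ Suc n) * indicator (shifted_level_set u (2 ^ n) k) x)))"

lemma shifted_level_set_sets [measurable]: "shifted_level_set u \<alpha> k \<in> sets unit_lebesgue"
  by (rule borel_unit_sets[OF shifted_level_set_borel shifted_level_set_subset])

lemma level_majorant_measurable [measurable]: "level_majorant u q \<kappa> \<in> borel_measurable unit_lebesgue"
  unfolding level_majorant_def by measurable

lemma emeasure_unit_interval: "emeasure unit_lebesgue {0..<1} = 1"
  by (simp add: emeasure_restrict_space)

lemma nn_integral_level_majorant_le:
  fixes u :: "real \<Rightarrow> real" and q \<kappa> :: real
  assumes int: "integrable unit_lebesgue u" and nonneg: "\<And>t. 0 \<le> u t" and q: "1 < q"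
    and mass: "(\<integral>\<^sup>+t. ennreal (u t powr q) \<partial>unit_lebesgue) \<le> 1"
    and \<kappa>: "0 \<le> \<kappa>" "\<kappa> < 1"
  defines "\<rho> \<equiv> 2 powr (q - 1)"
  shows "(\<integral>\<^sup>+x. level_majorant u q \<kappa> x \<partial>unit_lebesgue)
       \<le> ennreal (2 powr q * (1 + 4 * \<rho> ^ 3 / (\<rho> - 1)) * (1 / (1 - \<kappa>)\<^sup>2))"
proof -
  define D where "D = 4 * \<rho> ^ 3 / (\<rho> - 1)"
  have "1 < \<rho>" using q by (simp add: \<rho>_def)
  then have D: "0 \<le> D" by (simp add: D_def)
  let ?S = "\<lambda>n k. shifted_level_set u (2 ^ n) k"
  have inner: "(\<integral>\<^sup>+x. 1 + (\<Sum>n. ennreal ((2 powr q) ^ Suc n) * indicator (?S n k) x) \<partial>unit_lebesgue)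
      \<le> ennreal (real (Suc k) * (1 + D))" for k
  proof -
    have "(\<integral>\<^sup>+x. 1 + (\<Sum>n. ennreal ((2 powr q) ^ Suc n) * indicator (?S n k) x) \<partial>unit_lebesgue)
        = 1 + (\<integral>\<^sup>+x. (\<Sum>n. ennreal ((2 powr q) ^ Suc n) * indicator (?S n k) x) \<partial>unit_lebesgue)"
      by (subst nn_integral_add) (auto simp: emeasure_unit_interval)
    also have "(\<integral>\<^sup>+x. (\<Sum>n. ennreal ((2 powr q) ^ Suc n) * indicator (?S n k) x) \<partial>unit_lebesgue)
        = (\<Sum>n. ennreal ((2 powr q) ^ Suc n) * emeasure unit_lebesgue (?S n k))"
      by (subst nn_integral_suminf) (auto simp: nn_integral_cmult_indicator simp del: power_Suc)
    also have "\<dots> \<le> ennreal (real (Suc k) * D) * (\<integral>\<^sup>+t. ennreal (u t powr q) \<partial>unit_lebesgue)"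
      unfolding D_def \<rho>_def by (rule shifted_maximal_inequality[OF int nonneg q])
    also have "\<dots> \<le> ennreal (real (Suc k) * D) * 1"
      by (intro mult_left_mono mass) simp
    also have "1 + ennreal (real (Suc k) * D) * 1 = ennreal (1 + real (Suc k) * D)"
      using D by (subst ennreal_plus) auto
    also have "\<dots> \<le> ennreal (real (Suc k) * (1 + D))"
      by (intro ennreal_leI) (simp add: algebra_simps)
    finally show ?thesis by (simp add: add_left_mono)
  qed
  have "(\<integral>\<^sup>+x. level_majorant u q \<kappa> x \<partial>unit_lebesgue)
      = (\<Sum>k. ennreal (\<kappa> ^ k * 2 powr q) *
          (\<integral>\<^sup>+x. 1 + (\<Sum>n. ennreal ((2 powr q) ^ Suc n) * indicator (?S n k) x) \<partial>unit_lebesgue))"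
    unfolding level_majorant_def
    by (subst nn_integral_suminf) (measurable, intro suminf_cong nn_integral_cmult, measurable)
  also have "\<dots> \<le> (\<Sum>k. ennreal (\<kappa> ^ k * 2 powr q) * ennreal (real (Suc k) * (1 + D)))"
    by (intro suminf_le mult_left_mono inner) auto
  also have "\<dots> = (\<Sum>k. ennreal (2 powr q * (1 + D) * (real (Suc k) * \<kappa> ^ k)))"
    using \<kappa> D by (intro suminf_cong) (subst ennreal_mult[symmetric], auto simp: mult_ac)
  also have "\<dots> = ennreal (2 powr q * (1 + D) * (1 / (1 - \<kappa>)\<^sup>2))"
  proof (rule suminf_ennreal_eq)
    show "(\<lambda>k. 2 powr q * (1 + D) * (real (Suc k) * \<kappa> ^ k)) sums (2 powr q * (1 + D) * (1 / (1 - \<kappa>)\<^sup>2))"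
      using \<kappa> by (intro sums_mult geometric_deriv_sums) auto
  qed (use \<kappa> D in auto)
  finally show ?thesis by (simp add: D_def)
qed

lemma powr_le_level_majorant:
  assumes "x \<in> {0..<1}" "k \<le> i" "\<And>t. 0 \<le> u t" "1 < q" "0 \<le> \<kappa>"
  shows "ennreal (\<kappa> ^ k * (1 + cell_mean i u (flip (i - k) x)) powr q) \<le> level_majorant u q \<kappa> x"
proof -
  define v where "v = cell_mean i u (flip (i - k) x)"
  have v: "0 \<le> v" unfolding v_def by (rule cell_mean_nonneg) (rule assms)
  define g where "g k = ennreal (\<kappa> ^ k * 2 powr q) *
      (1 + (\<Sum>n. ennreal ((2 powr q) ^ Suc n) * indicator (shifted_level_set u (2 ^ n) k) x))" for k
  have "ennreal (\<kappa> ^ k * (1 + v) powr q) = ennreal (\<kappa> ^ k) * ennreal ((1 + v) powr q)"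
    using assms by (intro ennreal_mult) auto
  also have "\<dots> \<le> ennreal (\<kappa> ^ k) * (ennreal (2 powr q) * (1 + (\<Sum>n. ennreal ((2 powr q) ^ Suc n) * indicator {m. 2 ^ m < v} n)))"
    by (intro mult_left_mono one_plus_powr_le v assms) simp
  also have "\<dots> = ennreal (\<kappa> ^ k * 2 powr q) * (1 + (\<Sum>n. ennreal ((2 powr q) ^ Suc n) * indicator {m. 2 ^ m < v} n))"
    using assms by (subst ennreal_mult) (auto simp: mult_ac)
  also have "\<dots> \<le> g k"
    unfolding g_def
  proof (intro mult_left_mono add_left_mono suminf_le)
    fix n
    have "2 ^ n < v \<Longrightarrow> x \<in> shifted_level_set u (2 ^ n) k"
      using assms(1,2) by (auto simp: shifted_level_set_def v_def)
    then show "(indicator {m. 2 ^ m < v} n :: ennreal) \<le> indicator (shifted_level_set u (2 ^ n) k) x"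
      by (auto simp: indicator_def)
  qed auto
  also have "\<dots> \<le> suminf g"
    by (rule term_le_suminf_ennreal)
  also have "\<dots> = level_majorant u q \<kappa> x"
    by (simp only: level_majorant_def g_def[abs_def])
  finally show ?thesis by (simp only: v_def)
qed

text \<open>Comparison of the mean of \<open>G\<^sup>r\<close> with the mean \<open>v\<close> of \<open>G\<^bsup>p/q\<^esup>\<close>, for a constant lower bound \<open>s\<close> of the exponent.
  Where \<open>G\<^sup>r\<close> exceeds \<open>(1 + v)\<^bsup>rq/s\<^esup>\<close>, raising the quotient to the power \<open>s/(rq) \<ge> 1\<close> increases it.\<close>

lemma cell_mean_powr_le:
  fixes G p :: "real \<Rightarrow> real"
  assumes G: "\<And>t. 0 \<le> G t" and r: "0 < r" and q: "0 < q" and s: "r * q \<le> s"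
    and intr: "integrable unit_lebesgue (\<lambda>t. G t powr r)"
    and intu: "integrable unit_lebesgue (\<lambda>t. G t powr (p t / q))"
    and y: "y \<in> {0..<1}"
    and p: "AE t in unit_lebesgue. t \<in> cell i y \<longrightarrow> s \<le> p t"
  shows "cell_mean i (\<lambda>t. G t powr r) y powr (1 / r)
       \<le> 2 powr (1 / r) * (1 + cell_mean i (\<lambda>t. G t powr (p t / q)) y) powr (q / s)"
proof -
  let ?u = "\<lambda>t. G t powr (p t / q)"
  define w where "w = 1 + cell_mean i ?u y"
  have "0 \<le> cell_mean i ?u y" by (rule cell_mean_nonneg) simp
  then have w: "1 \<le> w" by (simp add: w_def)
  define e where "e = r * q / s"
  have s0: "0 < s" using r q s mult_pos_pos[OF r q] by linarith
  have e: "0 < e" "e \<le> 1" using r q s s0 by (auto simp: e_def)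
  define c where "c = w powr e"
  have c: "0 < c" using w by (simp add: c_def)
  have "cell_mean i (\<lambda>t. G t powr r) y \<le> cell_mean i (\<lambda>t. c * (1 + 1 / w) + c / w * ?u t) y"
  proof (rule cell_mean_mono[OF intr])
    show "integrable unit_lebesgue (\<lambda>t. c * (1 + 1 / w) + c / w * ?u t)"
      by (intro Bochner_Integration.integrable_add integrable_const_unit integrable_mult_right intu)
    show "AE t in unit_lebesgue. t \<in> cell i y \<longrightarrow> G t powr r \<le> c * (1 + 1 / w) + c / w * ?u t"
      using p
    proof eventually_elim
      case (elim t)
      show ?case
      proof
        assume "t \<in> cell i y"
        with elim have st: "s \<le> p t" by simp
        show "G t powr r \<le> c * (1 + 1 / w) + c / w * ?u t"
        proof (cases "G t powr r \<le> c")
          case True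
          moreover have "c * 1 \<le> c * (1 + 1 / w)" using c w by (intro mult_left_mono) auto
          moreover have "0 \<le> c / w * ?u t" using c w by simp
          ultimately show ?thesis by linarith
        next
          case False
          have "(G t powr r / c) powr 1 \<le> (G t powr r / c) powr (1 / e)"
            using False c e by (intro powr_mono) auto
          then have "G t powr r / c \<le> (G t powr r / c) powr (1 / e)"
            using c by simp
          also have "\<dots> = G t powr (s / q) / w"
            using c w r q s0 by (simp add: powr_divide powr_powr c_def e_def)
          finally have "G t powr r \<le> c * (G t powr (s / q) / w)"
            using c by (simp add: divide_le_eq mult.commute)
          also have "G t powr (s / q) \<le> 1 + ?u t"
          proof (cases "G t \<le> 1")
            case True
            have "G t powr (s / q) \<le> 1 powr (s / q)" using G True s0 q by (intro powr_mono2) auto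
            then show ?thesis by (simp add: add_increasing2)
          next
            case False
            then have "G t powr (s / q) \<le> ?u t" using st q by (intro powr_mono divide_right_mono) auto
            then show ?thesis by simp
          qed
          then have "c * (G t powr (s / q) / w) \<le> c * ((1 + ?u t) / w)"
            using c w by (intro mult_left_mono divide_right_mono) auto
          also have "\<dots> = c * (1 / w) + c / w * ?u t"
            by (simp add: add_divide_distrib distrib_left)
          also have "\<dots> \<le> c * (1 + 1 / w) + c / w * ?u t"
            using c by (intro add_right_mono mult_left_mono) auto
          finally show ?thesis .
        qed
      qed
    qed
  qed
  also have "\<dots> = c * (1 + 1 / w) + c / w * cell_mean i ?u y"
    using cell_mean_add[OF integrable_const_unit integrable_mult_right[OF intu], of i "c * (1 + 1 / w)" "c / w" y]
    by (simp only: cell_mean_const[OF y] cell_mean_cmult)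
  also have "cell_mean i ?u y = w - 1" by (simp add: w_def)
  also have "c * (1 + 1 / w) + c / w * (w - 1) = 2 * c"
    using w by (simp add: field_simps)
  finally have "cell_mean i (\<lambda>t. G t powr r) y powr (1 / r) \<le> (2 * c) powr (1 / r)"
    using r by (intro powr_mono2 cell_mean_nonneg) auto
  also have "\<dots> = 2 powr (1 / r) * w powr (q / s)"
    using c r w by (subst powr_mult) (auto simp: c_def powr_powr e_def)
  finally show ?thesis by (simp add: w_def)
qed

text \<open>Passing from the exponent \<open>q/s\<close> to \<open>q/p(x)\<close>, where \<open>s\<close> bounds the exponent from below on an interval of length
  \<open>2\<^bsup>k - i\<^esup>\<close>. The regularity of the exponent controls the part of \<open>w\<close> that is due to the length of
  this interval, and the remaining \<open>k\<close> generations cost a factor \<open>2\<^bsup>qD\<^esup>\<close> each.\<close>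

lemma powr_exponent_change:
  fixes w q s px D K :: real
  assumes w: "1 \<le> w" "w \<le> 2 ^ (i + 2)" and q: "0 < q" and ki: "k \<le> i"
    and m: "0 < m" "m \<le> s" "s \<le> px" and D: "1 / s - 1 / px \<le> D"
    and K: "1 \<le> K" "(2 ^ (i - k)) powr (px - s) \<le> K"
  shows "w powr (q / s) \<le> K powr (q / m\<^sup>2) * (2 powr (q * D)) ^ (k + 2) * w powr (q / px)"
proof -
  define d where "d = 1 / s - 1 / px"
  have d0: "0 \<le> d" using m by (simp add: d_def frac_le)
  have "q / s = q * d + q / px" by (simp add: d_def algebra_simps)
  then have "w powr (q / s) = w powr (q * d) * w powr (q / px)"
    by (simp add: powr_add)
  also have "w powr (q * d) \<le> (2 ^ (i + 2)) powr (q * d)"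
    using w q d0 by (intro powr_mono2) auto
  also have "(2::real) ^ (i + 2) = 2 ^ (i - k) * 2 ^ (k + 2)"
    using ki by (subst power_add[symmetric]) simp
  also have "\<dots> powr (q * d) = (2 ^ (i - k)) powr (q * d) * (2 ^ (k + 2)) powr (q * d)"
    by (subst powr_mult) auto
  also have "(2 ^ (i - k)) powr (q * d) \<le> K powr (q / m\<^sup>2)"
  proof -
    have "q * d = (px - s) * (q / (s * px))"
      using m by (simp add: d_def field_simps)
    then have "((2::real) ^ (i - k)) powr (q * d) = ((2 ^ (i - k)) powr (px - s)) powr (q / (s * px))"
      by (simp add: powr_powr)
    also have "\<dots> \<le> K powr (q / (s * px))"
      using K q m by (intro powr_mono2) auto
    also have "\<dots> \<le> K powr (q / m\<^sup>2)"
    proof (intro powr_mono K divide_left_mono)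
      show "m\<^sup>2 \<le> s * px" unfolding power2_eq_square using m by (intro mult_mono) auto
    qed (use q m in auto)
    finally show ?thesis .
  qed
  also have "(2 ^ (k + 2)) powr (q * d) \<le> (2 ^ (k + 2)) powr (q * D)"
    using q D one_le_power[of "2::real" "k + 2"] by (intro powr_mono mult_left_mono) (auto simp: d_def)
  also have "((2::real) ^ (k + 2)) powr (q * D) = (2 powr (q * D)) ^ (k + 2)"
    by (simp only: powr_realpow[symmetric] powr_powr mult.commute zero_less_numeral powr_gt_zero)
  finally show ?thesis by (simp add: mult_left_mono mult_right_mono)
qed

section \<open>Regular exponents\<close>

lemma AE_exponent_bounds:
  assumes "A \<in> sets unit_lebesgue"
  shows "AE x in unit_lebesgue. x \<in> A \<longrightarrow> p_minus p A \<le> ereal (p x) \<and> ereal (p x) \<le> p_plus p A"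
proof -
  have A: "A \<in> sets lebesgue" "A \<subseteq> {0..<1}"
    using assms by (auto simp: sets_restrict_space_iff)
  have "AE x in lebesgue_on A. ereal (p x) \<le> p_plus p A"
    unfolding p_plus_def by (rule esssup_AE)
  moreover have "AE x in lebesgue_on A. p_minus p A \<le> ereal (p x)"
    using esssup_AE[of "\<lambda>x. - ereal (p x)" "lebesgue_on A"]
    by eventually_elim (simp only: p_minus_def essinf_def ereal_uminus_le_reorder)
  ultimately have "AE x in lebesgue_on A. p_minus p A \<le> ereal (p x) \<and> ereal (p x) \<le> p_plus p A"
    by eventually_elim simp
  then have "AE x in lebesgue. x \<in> A \<longrightarrow> p_minus p A \<le> ereal (p x) \<and> ereal (p x) \<le> p_plus p A"
    using A by (subst (asm) AE_restrict_space_iff) auto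
  then show ?thesis
    by (subst AE_restrict_space_iff) auto
qed

lemma exponent_bounds_mono:
  assumes p: "p \<in> borel_measurable unit_lebesgue" and "A \<in> sets unit_lebesgue"
  shows "p_minus p {0..<1} \<le> p_minus p A" "p_plus p A \<le> p_plus p {0..<1}"
proof -
  have A: "A \<in> sets lebesgue" "A \<subseteq> {0..<1}"
    using assms by (auto simp: sets_restrict_space_iff)
  have pA[measurable]: "p \<in> borel_measurable (lebesgue_on A)"
    by (rule measurable_restrict_mono[OF p A(2)])
  have "AE x in unit_lebesgue. x \<in> {0..<1} \<longrightarrow> p_minus p {0..<1} \<le> ereal (p x) \<and> ereal (p x) \<le> p_plus p {0..<1}"
    using AE_exponent_bounds[of "{0..<1}" p] by (simp add: sets_restrict_space_iff)
  then have AE: "AE x in lebesgue_on A. p_minus p {0..<1} \<le> ereal (p x) \<and> ereal (p x) \<le> p_plus p {0..<1}"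
    using A by (subst (asm) AE_restrict_space_iff) (auto simp: AE_restrict_space_iff elim!: eventually_mono)
  show "p_plus p A \<le> p_plus p {0..<1}"
    unfolding p_plus_def[of p A] using AE by (intro esssup_I) auto
  have "esssup (lebesgue_on A) (\<lambda>x. - ereal (p x)) \<le> - p_minus p {0..<1}"
    using AE by (intro esssup_I) (auto simp: ereal_minus_le_minus simp del: uminus_ereal.simps)
  then show "p_minus p {0..<1} \<le> p_minus p A"
    unfolding p_minus_def[of p A] essinf_def by (metis ereal_minus_le_minus ereal_uminus_uminus)
qed

text \<open>The hypothesis on dyadic intervals in the form in which it is used: at almost every point, the
  exponent exceeds its lower bound on the surrounding dyadic interval of length \<open>2\<^sup>-\<^sup>i\<close> by at most a constant over \<open>i\<close>.\<close>

lemma AE_exponent_regularity: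
  fixes p :: "real \<Rightarrow> real" and m M K :: real
  assumes p: "p \<in> borel_measurable unit_lebesgue"
    and m: "p_minus p {0..<1} = ereal m" and M: "p_plus p {0..<1} = ereal M"
    and K: "\<And>n A. A \<in> dyadic_intervals n \<Longrightarrow>
           measure unit_lebesgue A powr real_of_ereal (p_minus p A - p_plus p A) \<le> K"
  shows "AE x in unit_lebesgue. p x \<le> M \<and> (\<forall>i. m \<le> real_of_ereal (p_minus p (cell i x))
           \<and> real_of_ereal (p_minus p (cell i x)) \<le> p x
           \<and> (2 ^ i) powr (p x - real_of_ereal (p_minus p (cell i x))) \<le> K)"
proof -
  have sets: "A \<in> sets unit_lebesgue" if "A \<in> dyadic_intervals i" for A i
  proof (cases "A = {}")
    case False
    then obtain x where "x \<in> A" by blast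
    from dyadic_interval_eq_cell[OF that this] show ?thesis using cell_unit_sets by simp
  qed simp
  have "AE x in unit_lebesgue. \<forall>i. \<forall>A\<in>dyadic_intervals i.
      x \<in> A \<longrightarrow> p_minus p A \<le> ereal (p x) \<and> ereal (p x) \<le> p_plus p A"
    unfolding AE_all_countable using AE_exponent_bounds[OF sets]
    by (auto simp: AE_ball_countable[OF countable_finite[OF finite_dyadic_intervals]])
  then show ?thesis
    using AE_space
  proof eventually_elim
    case (elim x)
    then have x: "x \<in> {0..<1}" by simp
    have main: "m \<le> real_of_ereal (p_minus p (cell i x)) \<and> real_of_ereal (p_minus p (cell i x)) \<le> p x
        \<and> (2 ^ i) powr (p x - real_of_ereal (p_minus p (cell i x))) \<le> K \<and> p x \<le> M" for i
    proof -
      let ?A = "cell i x"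
      have dy: "?A \<in> dyadic_intervals i" by (rule cell_in_dyadic_intervals[OF x])
      have b: "p_minus p ?A \<le> ereal (p x)" "ereal (p x) \<le> p_plus p ?A"
        using elim(1) dy cell_refl by blast+
      have c: "ereal m \<le> p_minus p ?A" "p_plus p ?A \<le> ereal M"
        using exponent_bounds_mono[OF p sets[OF dy]] m M by auto
      obtain s where s: "p_minus p ?A = ereal s" using b(1) c(1) by (cases "p_minus p ?A") auto
      obtain t where t: "p_plus p ?A = ereal t" using b(2) c(2) by (cases "p_plus p ?A") auto
      have "(2 ^ i) powr (p x - s) \<le> (2 ^ i) powr (t - s)"
        using b t by (intro powr_mono) auto
      also have "\<dots> = (1 / 2 ^ i) powr (s - t)"
        by (simp add: powr_divide powr_minus_divide[symmetric])
      also have "\<dots> = measure unit_lebesgue ?A powr real_of_ereal (p_minus p ?A - p_plus p ?A)"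
        using emeasure_cell[OF x, of i] by (simp add: measure_def s t)
      also have "\<dots> \<le> K" by (rule K[OF dy])
      finally show ?thesis using b c by (simp add: s t)
    qed
    then show ?case by blast
  qed
qed

lemma powr_le_one_plus:
  fixes g e f :: real
  assumes "0 \<le> g" "0 \<le> e" "e \<le> f"
  shows "g powr e \<le> 1 + g powr f"
proof (cases "g \<le> 1")
  case True
  have "g powr e \<le> 1" using assms True by (intro powr_le1) auto
  then show ?thesis by (simp add: add_increasing2)
next
  case False
  then have "g powr e \<le> g powr f" using assms by (intro powr_mono) auto
  then show ?thesis by simp
qed

text \<open>The variable exponent estimate: if the modular of \<open>G\<close> is at most \<open>1\<close>, the shifted means of \<open>G\<^sup>r\<close> are controlled,
  up to a growth \<open>b\<^sup>k\<close>, by \<open>Z\<^bsup>1/p\<^esup>\<close> for a function \<open>Z\<close> whose integral is bounded independently of \<open>G\<close>.\<close>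

lemma shifted_means_le:
  fixes p G :: "real \<Rightarrow> real" and s :: "real set \<Rightarrow> real" and m M K r q b :: real
  assumes [measurable]: "p \<in> borel_measurable unit_lebesgue" "G \<in> borel_measurable unit_lebesgue"
    and G: "\<And>t. 0 \<le> G t" "(\<integral>\<^sup>+t. ennreal (G t powr p t) \<partial>unit_lebesgue) \<le> 1"
    and reg: "AE x in unit_lebesgue. p x \<le> M \<and>
          (\<forall>i. m \<le> s (cell i x) \<and> s (cell i x) \<le> p x \<and> (2 ^ i) powr (p x - s (cell i x)) \<le> K)"
    and m: "0 < m" and K: "1 \<le> K" and r: "0 < r" and q: "1 < q" "r * q \<le> m"
    and b: "2 powr (q * (1 / m - 1 / M)) < b"
  defines "\<theta> \<equiv> 2 powr (q * (1 / m - 1 / M))"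
  defines "Z \<equiv> level_majorant (\<lambda>t. G t powr (p t / q)) q ((\<theta> / b) powr m)"
  defines "\<rho> \<equiv> 2 powr (q - 1)"
  shows "integrable unit_lebesgue (\<lambda>t. G t powr r)"
    and "(\<integral>\<^sup>+x. Z x \<partial>unit_lebesgue)
           \<le> ennreal (2 powr q * (1 + 4 * \<rho> ^ 3 / (\<rho> - 1)) * (1 / (1 - (\<theta> / b) powr m)\<^sup>2))"
    and "AE x in unit_lebesgue. \<forall>i k. k \<le> i \<longrightarrow> Z x < \<infinity> \<longrightarrow>
           cell_mean i (\<lambda>t. G t powr r) (flip (i - k) x) powr (1 / r)
           \<le> b ^ k * (2 powr (1 / r) * K powr (q / m\<^sup>2) * \<theta>\<^sup>2 * enn2real (Z x) powr (1 / p x))"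
proof -
  define u where "u t = G t powr (p t / q)" for t
  have [measurable]: "u \<in> borel_measurable unit_lebesgue" unfolding u_def by measurable
  have u0: "0 \<le> u t" for t by (simp add: u_def)
  have pm: "AE x in unit_lebesgue. m \<le> p x"
    using reg by eventually_elim (meson order_trans)
  have intp: "integrable unit_lebesgue (\<lambda>t. G t powr p t)"
    using G(2) by (intro integrableI_bounded) (auto simp: top.not_eq_extremum intro: le_less_trans)
  then have int1p: "integrable unit_lebesgue (\<lambda>t. 1 + G t powr p t)"
    using integrable_const_unit by (intro Bochner_Integration.integrable_add)
  have rm: "r \<le> m" using r q mult_left_mono[of 1 q r] by linarith
  show intr: "integrable unit_lebesgue (\<lambda>t. G t powr r)"
  proof (rule Bochner_Integration.integrable_bound[OF int1p])
    show "AE t in unit_lebesgue. norm (G t powr r) \<le> norm (1 + G t powr p t)"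
      using pm by eventually_elim (use G(1) rm r powr_le_one_plus in \<open>simp add: add_nonneg_nonneg\<close>)
  qed measurable
  have u_le: "AE t in unit_lebesgue. u t \<le> 1 + G t powr p t"
    using pm
  proof eventually_elim
    case (elim t)
    then have "0 \<le> p t / q" "p t / q \<le> p t"
      using m q by (auto simp: divide_le_eq)
    then show ?case unfolding u_def using G(1) by (intro powr_le_one_plus)
  qed
  have intu: "integrable unit_lebesgue u"
  proof (rule Bochner_Integration.integrable_bound[OF int1p])
    show "AE t in unit_lebesgue. norm (u t) \<le> norm (1 + G t powr p t)"
      using u_le by eventually_elim (use u0 in \<open>simp add: add_nonneg_nonneg\<close>)
  qed measurable
  have "ennreal (\<integral>t. G t powr p t \<partial>unit_lebesgue) \<le> 1"
    using G(2) nn_integral_eq_integral[OF intp] by simp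
  then have "(\<integral>t. G t powr p t \<partial>unit_lebesgue) \<le> 1"
    by simp
  moreover have "(\<integral>t. u t \<partial>unit_lebesgue) \<le> (\<integral>t. 1 + G t powr p t \<partial>unit_lebesgue)"
    by (intro integral_mono_AE intu int1p u_le)
  moreover have "(\<integral>t. 1 + G t powr p t \<partial>unit_lebesgue) = 1 + (\<integral>t. G t powr p t \<partial>unit_lebesgue)"
    using intp integrable_const_unit emeasure_unit_interval
    by (subst Bochner_Integration.integral_add) (auto simp: measure_def)
  ultimately have mass_u: "(\<integral>t. u t \<partial>unit_lebesgue) \<le> 2" by linarith
  have \<theta>: "0 < \<theta>" "\<theta> < b" using b by (auto simp: \<theta>_def)
  define \<eta> where "\<eta> = \<theta> / b"
  have \<eta>: "0 < \<eta>" "\<eta> < 1" using \<theta> by (auto simp: \<eta>_def)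
  define \<kappa> where "\<kappa> = \<eta> powr m"
  have "\<eta> powr m < \<eta> powr 0" using \<eta> m by (intro powr_less_mono') auto
  then have \<kappa>: "0 \<le> \<kappa>" "\<kappa> < 1" using \<eta> by (auto simp: \<kappa>_def)
  have Z: "Z = level_majorant u q \<kappa>" by (simp add: Z_def u_def[abs_def] \<kappa>_def \<eta>_def)
  have "(\<integral>\<^sup>+t. ennreal (u t powr q) \<partial>unit_lebesgue) \<le> 1"
    using G(2) q by (simp add: u_def powr_powr)
  from nn_integral_level_majorant_le[OF intu u0 q(1) this \<kappa>]
  show "(\<integral>\<^sup>+x. Z x \<partial>unit_lebesgue)
           \<le> ennreal (2 powr q * (1 + 4 * \<rho> ^ 3 / (\<rho> - 1)) * (1 / (1 - (\<theta> / b) powr m)\<^sup>2))"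
    unfolding Z \<rho>_def \<kappa>_def \<eta>_def .
  show "AE x in unit_lebesgue. \<forall>i k. k \<le> i \<longrightarrow> Z x < \<infinity> \<longrightarrow>
           cell_mean i (\<lambda>t. G t powr r) (flip (i - k) x) powr (1 / r)
           \<le> b ^ k * (2 powr (1 / r) * K powr (q / m\<^sup>2) * \<theta>\<^sup>2 * enn2real (Z x) powr (1 / p x))"
    using reg AE_space
  proof eventually_elim
    case (elim x)
    then have x: "x \<in> {0..<1}" by simp
    show ?case
    proof (intro allI impI)
      fix i k :: nat assume ki: "k \<le> i" and fin: "Z x < \<infinity>"
      define y where "y = flip (i - k) x"
      have y: "y \<in> {0..<1}" unfolding y_def by (rule flip_in_unit[OF x])
      define \<sigma> where "\<sigma> = s (cell (i - k) x)"
      have \<sigma>: "m \<le> \<sigma>" "\<sigma> \<le> p x" "(2 ^ (i - k)) powr (p x - \<sigma>) \<le> K" "p x \<le> M"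
        using elim(1) by (auto simp: \<sigma>_def)
      have px: "0 < p x" "m \<le> p x" using m \<sigma> by auto
      have p\<sigma>: "AE t in unit_lebesgue. t \<in> cell i y \<longrightarrow> \<sigma> \<le> p t"
        using reg
      proof eventually_elim
        case (elim t)
        show ?case
        proof
          assume "t \<in> cell i y"
          then have "t \<in> cell (i - k) y" using cell_antimono[of "i - k" i y] by auto
          then have "cell (i - k) t = cell (i - k) x"
            unfolding y_def by (metis cell_cong cell_flip order_refl)
          then show "\<sigma> \<le> p t" using elim by (metis \<sigma>_def)
        qed
      qed
      define w where "w = 1 + cell_mean i u y"
      have v0: "0 \<le> cell_mean i u y" by (rule cell_mean_nonneg) (rule u0)
      then have w1: "1 \<le> w" by (simp add: w_def)
      have "cell_mean i u y \<le> 2 ^ i * cell_mean 0 u y"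
        using cell_mean_le_coarser[OF intu u0, of 0 i y] by simp
      also have "cell_mean 0 u y \<le> (\<integral>t. u t \<partial>unit_lebesgue)"
        unfolding cell_mean_def using u0
        by (simp, intro integral_mono intu integrable_indicator_cell) (auto simp: indicator_def)
      also have "\<dots> \<le> 2" by (rule mass_u)
      finally have "w \<le> 1 + 2 ^ i * 2" by (simp add: w_def)
      also have "\<dots> \<le> 2 ^ (i + 2)"
      proof -
        have "(1::real) \<le> 2 ^ i" "(2::real) ^ (i + 2) = 4 * 2 ^ i" by simp_all
        then show ?thesis by linarith
      qed
      finally have w2: "w \<le> 2 ^ (i + 2)" .
      have mean: "cell_mean i (\<lambda>t. G t powr r) y powr (1 / r) \<le> 2 powr (1 / r) * w powr (q / \<sigma>)"
        unfolding w_def u_def using intu[unfolded u_def[abs_def]] q \<sigma>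
        by (intro cell_mean_powr_le G(1) r intr y p\<sigma>) auto
      have change: "w powr (q / \<sigma>) \<le> K powr (q / m\<^sup>2) * \<theta> ^ (k + 2) * w powr (q / p x)"
        unfolding \<theta>_def
      proof (rule powr_exponent_change[OF w1 w2 _ ki m \<sigma>(1,2) _ K \<sigma>(3)])
        have "1 / \<sigma> \<le> 1 / m" "1 / M \<le> 1 / p x" using \<sigma> m px by (auto intro!: frac_le)
        then show "1 / \<sigma> - 1 / p x \<le> 1 / m - 1 / M" by linarith
      qed (use q in simp)
      have major: "\<theta> ^ k * w powr (q / p x) \<le> b ^ k * enn2real (Z x) powr (1 / p x)"
      proof -
        have "ennreal (\<kappa> ^ k * w powr q) \<le> Z x"
          unfolding Z w_def y_def by (rule powr_le_level_majorant[OF x ki u0 q(1) \<kappa>(1)])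
        then have "\<kappa> ^ k * w powr q \<le> enn2real (Z x)"
          using fin \<kappa> by (metis enn2real_mono enn2real_ennreal infinity_ennreal_def mult_nonneg_nonneg powr_ge_zero zero_le_power)
        then have "(\<kappa> ^ k * w powr q) powr (1 / p x) \<le> enn2real (Z x) powr (1 / p x)"
          using \<kappa> px by (intro powr_mono2) auto
        moreover have "(\<kappa> ^ k * w powr q) powr (1 / p x) = (\<eta> ^ k) powr (m / p x) * w powr (q / p x)"
          using \<eta> by (subst powr_mult) (auto simp: \<kappa>_def powr_powr powr_power powr_realpow[symmetric] mult_ac)
        \<comment> \<open>The exponent \<open>m\<close> in \<open>\<kappa> = \<eta>\<^sup>m\<close> is chosen for this step: \<open>m / p x \<le> 1\<close> and \<open>\<eta> < 1\<close>.\<close>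
        moreover have "(\<eta> ^ k) powr 1 \<le> (\<eta> ^ k) powr (m / p x)"
          using \<eta> m px by (intro powr_mono') (auto simp: power_le_one)
        then have "\<eta> ^ k * w powr (q / p x) \<le> (\<eta> ^ k) powr (m / p x) * w powr (q / p x)"
          using \<eta> by (intro mult_right_mono) auto
        ultimately have "\<eta> ^ k * w powr (q / p x) \<le> enn2real (Z x) powr (1 / p x)"
          by linarith
        then have "b ^ k * (\<eta> ^ k * w powr (q / p x)) \<le> b ^ k * enn2real (Z x) powr (1 / p x)"
          using \<theta> by (intro mult_left_mono) auto
        moreover have "b ^ k * \<eta> ^ k = \<theta> ^ k"
          using \<theta> by (simp add: \<eta>_def power_mult_distrib[symmetric])
        ultimately show ?thesis by (simp add: mult.assoc[symmetric])
      qed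
      have "cell_mean i (\<lambda>t. G t powr r) y powr (1 / r)
          \<le> 2 powr (1 / r) * (K powr (q / m\<^sup>2) * \<theta> ^ (k + 2) * w powr (q / p x))"
        by (rule order_trans[OF mean]) (intro mult_left_mono change, simp)
      also have "\<dots> = 2 powr (1 / r) * K powr (q / m\<^sup>2) * \<theta>\<^sup>2 * (\<theta> ^ k * w powr (q / p x))"
        by (simp add: power_add mult_ac power2_eq_square)
      also have "\<dots> \<le> 2 powr (1 / r) * K powr (q / m\<^sup>2) * \<theta>\<^sup>2 * (b ^ k * enn2real (Z x) powr (1 / p x))"
        by (intro mult_left_mono major) simp
      finally show "cell_mean i (\<lambda>t. G t powr r) (flip (i - k) x) powr (1 / r)
           \<le> b ^ k * (2 powr (1 / r) * K powr (q / m\<^sup>2) * \<theta>\<^sup>2 * enn2real (Z x) powr (1 / p x))"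
        by (simp add: y_def mult_ac)
    qed
  qed
qed

section \<open>Boundedness of the maximal Fejer operator\<close>

lemma ennreal_powr_le:
  assumes "a \<le> ennreal c" "0 \<le> c" "0 \<le> t"
  shows "ennreal_powr a t \<le> ennreal (c powr t)"
proof -
  have fin: "a < \<infinity>" using assms(1) by (metis ennreal_less_top infinity_ennreal_def le_less_trans)
  then have "enn2real a \<le> c" using assms(1,2) by (metis enn2real_leI)
  then have "enn2real a powr t \<le> c powr t" using assms(3) by (intro powr_mono2) auto
  then show ?thesis using fin by (auto simp: ennreal_powr_def ennreal_leI)
qed

lemma martingale_borel_measurable:
  assumes "martingale unit_lebesgue dyadic_filtration f"
  shows "f n \<in> borel_measurable unit_lebesgue"
  using assms measurable_from_subalg[OF subalgebra_dyadic_filtration] by (auto simp: martingale_def)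

lemma maximal_function_measurable:
  assumes "martingale unit_lebesgue dyadic_filtration f"
  shows "maximal_function f \<in> borel_measurable unit_lebesgue"
proof -
  note [measurable] = martingale_borel_measurable[OF assms]
  show ?thesis unfolding maximal_function_def by measurable
qed

text \<open>The modular inequality: normalizing \<open>M(f)\<close> by an admissible \<open>c\<close> makes \<open>C c\<close> admissible for the
  maximal Fejer operator.\<close>

lemma maximal_fejer_modular_le:
  fixes p :: "real \<Rightarrow> real" and s :: "real set \<Rightarrow> real" and m M K r q b :: real
  assumes p [measurable]: "p \<in> borel_measurable unit_lebesgue"
    and reg: "AE x in unit_lebesgue. p x \<le> M \<and>
          (\<forall>i. m \<le> s (cell i x) \<and> s (cell i x) \<le> p x \<and> (2 ^ i) powr (p x - s (cell i x)) \<le> K)"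
    and m: "0 < m" and K: "1 \<le> K" and r: "1 / 2 < r" "r \<le> 1" and q: "1 < q" "r * q \<le> m"
    and b: "2 powr (q * (1 / m - 1 / M)) < b" "b < 2"
  defines "\<theta> \<equiv> 2 powr (q * (1 / m - 1 / M))"
  defines "\<rho> \<equiv> 2 powr (q - 1)"
  defines "E \<equiv> max 1 (2 powr q * (1 + 4 * \<rho> ^ 3 / (\<rho> - 1)) * (1 / (1 - (\<theta> / b) powr m)\<^sup>2))"
  defines "C \<equiv> 4 / ((1 - b / 2) * (1 - 2 powr (1 / r - 1) / 2))
                 * (2 powr (1 / r) * K powr (q / m\<^sup>2) * \<theta>\<^sup>2) * E powr (1 / m)"
  shows "0 < C"
    and "\<lbrakk>martingale unit_lebesgue dyadic_filtration f; 0 < c;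
          (\<integral>\<^sup>+x. ennreal_powr (maximal_function f x / ennreal c) (p x) \<partial>unit_lebesgue) \<le> 1\<rbrakk> \<Longrightarrow>
        (\<integral>\<^sup>+x. ennreal_powr (maximal_fejer f x / ennreal (C * c)) (p x) \<partial>unit_lebesgue) \<le> 1"
proof -
  define A where "A = 4 / ((1 - b / 2) * (1 - 2 powr (1 / r - 1) / 2))"
  define L where "L = 2 powr (1 / r) * K powr (q / m\<^sup>2) * \<theta>\<^sup>2"
  have "1 / r - 1 < 1" using r by (simp add: field_simps)
  then have "2 powr (1 / r - 1) < (2 :: real) powr 1" by (intro powr_less_mono) auto
  then have A: "0 < A" unfolding A_def using b by (intro divide_pos_pos mult_pos_pos) auto
  have \<theta>: "0 < \<theta>" by (simp add: \<theta>_def)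
  then have L: "0 < L" using K by (simp add: L_def)
  have E: "1 \<le> E" by (simp add: E_def)
  have C: "C = A * L * E powr (1 / m)" by (simp add: C_def A_def L_def)
  show C0: "0 < C" using A L E by (simp add: C)
  assume f: "martingale unit_lebesgue dyadic_filtration f"
    and c: "0 < c" "(\<integral>\<^sup>+x. ennreal_powr (maximal_function f x / ennreal c) (p x) \<partial>unit_lebesgue) \<le> 1"
  note [measurable] = maximal_function_measurable[OF f]
  \<comment> \<open>The maximal function is finite almost everywhere, so that the real version loses nothing.\<close>
  define G where "G t = enn2real (maximal_function f t) / c" for t
  have G0: "0 \<le> G t" for t using c by (simp add: G_def)
  have [measurable]: "G \<in> borel_measurable unit_lebesgue" unfolding G_def by measurable
  have fin: "AE t in unit_lebesgue. maximal_function f t \<noteq> \<infinity>"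
  proof -
    have "AE x in unit_lebesgue. ennreal_powr (maximal_function f x / ennreal c) (p x) \<noteq> \<infinity>"
    proof (rule nn_integral_PInf_AE)
      show "(\<lambda>x. ennreal_powr (maximal_function f x / ennreal c) (p x)) \<in> borel_measurable unit_lebesgue"
        unfolding ennreal_powr_def by measurable
    qed (use c(2) in \<open>auto simp: top_unique\<close>)
    then show ?thesis
      by eventually_elim (auto simp: ennreal_powr_def ennreal_top_divide)
  qed
  have mod: "(\<integral>\<^sup>+t. ennreal (G t powr p t) \<partial>unit_lebesgue) \<le> 1"
  proof -
    have "AE t in unit_lebesgue. ennreal (G t powr p t) = ennreal_powr (maximal_function f t / ennreal c) (p t)"
      using fin
    proof eventually_elim
      case (elim t)
      then obtain g where g: "0 \<le> g" "maximal_function f t = ennreal g"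
        by (cases "maximal_function f t") auto
      then have "maximal_function f t / ennreal c = ennreal (g / c)"
        using c by (simp add: divide_ennreal)
      then show ?case using g c by (simp add: ennreal_powr_def G_def)
    qed
    then show ?thesis using c(2) by (subst nn_integral_cong_AE) auto
  qed
  have r0: "0 < r" using r by simp
  define Z where "Z = level_majorant (\<lambda>t. G t powr (p t / q)) q ((\<theta> / b) powr m)"
  have Z [measurable]: "Z \<in> borel_measurable unit_lebesgue" by (simp add: Z_def)
  note V = shifted_means_le[OF p _ G0 mod reg m K r0 q b(1), folded \<theta>_def \<rho>_def, folded Z_def L_def]
  have intr: "integrable unit_lebesgue (\<lambda>t. G t powr r)" by (rule V(1)) measurable
  have ZE: "(\<integral>\<^sup>+x. Z x \<partial>unit_lebesgue) \<le> ennreal E"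
    by (rule order_trans[OF V(2)]) (auto simp: E_def intro!: ennreal_leI)
  have Zfin: "AE x in unit_lebesgue. Z x \<noteq> \<infinity>"
    by (rule nn_integral_PInf_AE[OF Z]) (use ZE in \<open>auto simp: top_unique\<close>)
  have fG: "AE t in unit_lebesgue. \<bar>f N t\<bar> \<le> c * G t" for N
    using fin
  proof eventually_elim
    case (elim t)
    have "ennreal \<bar>f N t\<bar> \<le> maximal_function f t"
      unfolding maximal_function_def by (rule SUP_upper) simp
    then have "\<bar>f N t\<bar> \<le> enn2real (maximal_function f t)"
      using elim by (metis abs_ge_zero enn2real_ennreal enn2real_mono infinity_ennreal_def top.not_eq_extremum)
    then show ?case using c by (simp add: G_def)
  qed
  have cG: "(\<lambda>t. (c * G t) powr r) = (\<lambda>t. c powr r * (G t powr r))"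
    using c G0 by (auto simp: powr_mult)
  have "AE x in unit_lebesgue. \<forall>i k. k \<le> i \<longrightarrow> Z x < \<infinity> \<longrightarrow>
           cell_mean i (\<lambda>t. G t powr r) (flip (i - k) x) powr (1 / r) \<le> b ^ k * (L * enn2real (Z x) powr (1 / p x))"
    by (rule V(3)) measurable
  then have "AE x in unit_lebesgue. ennreal_powr (maximal_fejer f x / ennreal (C * c)) (p x) \<le> Z x * ennreal (1 / E)"
    using Zfin reg AE_space
  proof eventually_elim
    case (elim x)
    have x: "x \<in> {0..<1}" using elim(4) by simp
    have px: "m \<le> p x" using elim(3) order_trans by blast
    obtain z where z: "0 \<le> z" "Z x = ennreal z" using elim(2) by (cases "Z x") auto
    define B where "B = L * z powr (1 / p x)"
    have "\<bar>fejer_mean n f x\<bar> \<le> A * (c * B)" if "1 \<le> n" for n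
      unfolding A_def
    proof (rule abs_fejer_mean_le[OF f fG _ r _ b(2) x _ that])
      show "integrable unit_lebesgue (\<lambda>t. (c * G t) powr r)"
        unfolding cG by (intro integrable_mult_right intr)
      show "0 \<le> b" using b(1) powr_ge_zero[of 2 "q * (1 / m - 1 / M)"] by linarith
      fix i k :: nat assume "k \<le> i"
      then have le: "cell_mean i (\<lambda>t. G t powr r) (flip (i - k) x) powr (1 / r) \<le> b ^ k * B"
        using elim(1) z by (simp add: B_def)
      have "cell_mean i (\<lambda>t. (c * G t) powr r) (flip (i - k) x) powr (1 / r)
          = c * cell_mean i (\<lambda>t. G t powr r) (flip (i - k) x) powr (1 / r)"
        unfolding cG cell_mean_cmult using c r0
        by (subst powr_mult) (auto simp: powr_powr intro!: cell_mean_nonneg)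
      also have "\<dots> \<le> c * (b ^ k * B)" using c le by (intro mult_left_mono) auto
      finally show "cell_mean i (\<lambda>t. (c * G t) powr r) (flip (i - k) x) powr (1 / r) \<le> b ^ k * (c * B)"
        by (simp add: mult_ac)
    qed
    then have "maximal_fejer f x \<le> ennreal (A * (c * B))"
      unfolding maximal_fejer_def by (intro SUP_least ennreal_leI) auto
    then have "maximal_fejer f x / ennreal (C * c) \<le> ennreal (A * (c * B)) / ennreal (C * c)"
      by (rule divide_right_mono_ennreal)
    also have "\<dots> = ennreal (A * (c * B) / (C * c))"
      using A c L z C0 by (intro divide_ennreal) (auto simp: B_def)
    also have "A * (c * B) / (C * c) = z powr (1 / p x) / E powr (1 / m)"
      using A c L E by (simp add: C B_def)
    finally have "ennreal_powr (maximal_fejer f x / ennreal (C * c)) (p x)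
        \<le> ennreal ((z powr (1 / p x) / E powr (1 / m)) powr p x)"
      using px m by (intro ennreal_powr_le) auto
    also have "(z powr (1 / p x) / E powr (1 / m)) powr p x = z / E powr (p x / m)"
      using px m z by (simp add: powr_divide powr_powr)
    also have "z / E powr (p x / m) \<le> z / E"
    proof -
      have "E powr 1 \<le> E powr (p x / m)" using E px m by (intro powr_mono) auto
      then show ?thesis using E z by (intro divide_left_mono) auto
    qed
    then have "ennreal (z / E powr (p x / m)) \<le> ennreal (z / E)" by (rule ennreal_leI)
    also have "\<dots> = Z x * ennreal (1 / E)"
      using E z by (simp add: ennreal_mult[symmetric])
    finally show ?case .
  qed
  then have "(\<integral>\<^sup>+x. ennreal_powr (maximal_fejer f x / ennreal (C * c)) (p x) \<partial>unit_lebesgue)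
      \<le> (\<integral>\<^sup>+x. Z x * ennreal (1 / E) \<partial>unit_lebesgue)"
    by (rule nn_integral_mono_AE)
  also have "\<dots> = (\<integral>\<^sup>+x. Z x \<partial>unit_lebesgue) * ennreal (1 / E)"
    by (rule nn_integral_multc[OF Z])
  also have "\<dots> \<le> ennreal E * ennreal (1 / E)"
    by (intro mult_right_mono ZE) simp
  also have "\<dots> = 1"
    using E by (simp add: ennreal_mult[symmetric])
  finally show "(\<integral>\<^sup>+x. ennreal_powr (maximal_fejer f x / ennreal (C * c)) (p x) \<partial>unit_lebesgue) \<le> 1" .
qed

theorem theorem5p20:
  fixes p :: "real \<Rightarrow> real" and K :: real
  assumes "p \<in> borel_measurable unit_lebesgue"
    and "\<And>x. x \<in> {0..<1} \<Longrightarrow> 0 < p x"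
    and "0 < p_minus p {0..<1}"
    and "p_minus p {0..<1} \<le> p_plus p {0..<1}"
    and "p_plus p {0..<1} < \<infinity>"
    and "1 \<le> K"
    and "\<And>n A. A \<in> dyadic_intervals n \<Longrightarrow>
           measure unit_lebesgue A powr real_of_ereal (p_minus p A - p_plus p A) \<le> K"
    and "1 / p_minus p {0..<1} - 1 / p_plus p {0..<1} < 1"
    and "1 / 2 < p_minus p {0..<1}"
  shows "\<exists>C::real. C > 0 \<and>
           (\<forall>f \<in> hardy_space p. var_norm p (maximal_fejer f) \<le> ennreal C * hardy_norm p f)"
proof -
  obtain m where m: "p_minus p {0..<1} = ereal m"
    using assms(3-5) by (cases "p_minus p {0..<1}") auto
  obtain M where M: "p_plus p {0..<1} = ereal M"
    using assms(3-5) by (cases "p_plus p {0..<1}") auto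
  have m0: "0 < m" "m \<le> M" using assms(3,4) m M by auto
  have m2: "1 / 2 < m" using assms(9) unfolding m by (simp add: one_ereal_def numeral_eq_ereal)
  define d where "d = 1 / m - 1 / M"
  have d: "0 \<le> d" "d < 1"
    using assms(8) m0 unfolding m M d_def by (auto simp: one_ereal_def frac_le)
  \<comment> \<open>\<open>1/2 < r < min 1 m\<close>: the condition \<open>p\<^sub>- > 1/2\<close> leaves room for such an \<open>r\<close>.\<close>
  define r where "r = (1 / 2 + min 1 m) / 2"
  have r: "1 / 2 < r" "r \<le> 1" "r < m" using m2 by (auto simp: r_def min_def field_simps)
  \<comment> \<open>\<open>q > 1\<close> is needed for the strong type inequality, \<open>q d < 1\<close> for a growth rate \<open>b < 2\<close>; both are possible
     because \<open>r < m\<close> and \<open>d < 1\<close>.\<close>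
  define q where "q = min (m / r) (2 / (1 + d))"
  have q1: "1 < q" using r d by (auto simp: q_def)
  have "r * q \<le> r * (m / r)" using r by (intro mult_left_mono) (auto simp: q_def)
  then have q2: "r * q \<le> m" using r by simp
  have "q * d \<le> 2 / (1 + d) * d" using d by (intro mult_right_mono) (auto simp: q_def)
  also have "\<dots> < 1" using d by (simp add: field_simps)
  finally have "2 powr (q * d) < (2::real) powr 1" by (intro powr_less_mono) auto
  then obtain b :: real where b: "2 powr (q * (1 / m - 1 / M)) < b" "b < 2"
    using dense unfolding d_def by auto
  have reg: "AE x in unit_lebesgue. p x \<le> M \<and> (\<forall>i. m \<le> real_of_ereal (p_minus p (cell i x))
      \<and> real_of_ereal (p_minus p (cell i x)) \<le> p x
      \<and> (2 ^ i) powr (p x - real_of_ereal (p_minus p (cell i x))) \<le> K)"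
    by (rule AE_exponent_regularity[OF assms(1) m M]) (rule assms(7))
  note modular = maximal_fejer_modular_le[OF assms(1) reg m0(1) assms(6) r(1,2) q1 q2 b]
  obtain C where C: "0 < C" and mod: "\<And>f c. \<lbrakk>martingale unit_lebesgue dyadic_filtration f; 0 < c;
      (\<integral>\<^sup>+x. ennreal_powr (maximal_function f x / ennreal c) (p x) \<partial>unit_lebesgue) \<le> 1\<rbrakk> \<Longrightarrow>
      (\<integral>\<^sup>+x. ennreal_powr (maximal_fejer f x / ennreal (C * c)) (p x) \<partial>unit_lebesgue) \<le> 1"
    using that[OF modular] by blast
  show ?thesis
  proof (intro exI[of _ C] conjI C ballI)
    fix f assume "f \<in> hardy_space p"
    then have f: "martingale unit_lebesgue dyadic_filtration f" by (simp add: hardy_space_def)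
    have "var_norm p (maximal_fejer f) / ennreal C \<le> hardy_norm p f"
      unfolding hardy_norm_def var_norm_def[of p "maximal_function f"]
    proof (intro INF_greatest)
      fix c assume "c \<in> {c. 0 < c \<and> (\<integral>\<^sup>+x. ennreal_powr (maximal_function f x / ennreal c) (p x) \<partial>unit_lebesgue) \<le> 1}"
      then have c: "0 < c" "(\<integral>\<^sup>+x. ennreal_powr (maximal_function f x / ennreal c) (p x) \<partial>unit_lebesgue) \<le> 1" by auto
      have "var_norm p (maximal_fejer f) \<le> ennreal (C * c)"
        unfolding var_norm_def using mod[OF f c] C c by (intro INF_lower) simp
      then have "var_norm p (maximal_fejer f) / ennreal C \<le> ennreal (C * c) / ennreal C"
        by (rule divide_right_mono_ennreal)
      also have "\<dots> = ennreal c" using C c by (simp add: divide_ennreal)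
      finally show "var_norm p (maximal_fejer f) / ennreal C \<le> ennreal c" .
    qed
    then have "ennreal C * (var_norm p (maximal_fejer f) / ennreal C) \<le> ennreal C * hardy_norm p f"
      by (intro mult_left_mono) auto
    then show "var_norm p (maximal_fejer f) \<le> ennreal C * hardy_norm p f"
      using C by (simp add: ennreal_times_divide mult_divide_eq_ennreal mult.commute[of "ennreal C"])
  qed
qed

end
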